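(* In the covariate-adaptive randomization setting described in the context, suppose that as $n\to\infty$: (A1) (global balance) $n^{-1}\sum_{i=1}^n(2T_i-1)\overset{p}{\rightarrow}0$; (A2) (covariate balance) $n^{-1/2}\sum_{i=1}^n(2T_i-1)\bm{x}_i\overset{d}{\rightarrow}\bm{\xi}$, where $\bm{\xi}$ is a $(p+q)$-dimensional random vector with $\mathbb{E}[\bm{\xi}]=\bm{0}$. Then the ordinary least squares estimator of the working model is consistent, i.e. $\hat{\bm{\theta}}\overset{p}{\rightarrow}\bm{\theta}$, and furthermore $$\sqrt{n}(\hat{\bm{\theta}}-\bm{\theta})=\frac{1}{\sqrt{n}}\mathbf{V}^{-1}\mathbf{G}^t\left(\mathbf{X}_{\mathrm{ex}}\bm{\beta}_{\mathrm{ex}}+\bm{\epsilon}\right)+\bm{o}_P(1),$$ where $\mathbf{V}=\mathrm{diag}\left(1/2,1/2,\mathrm{Var}(X_1),\dots,\mathrm{Var}(X_p)\right)$.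
   Context: Setting. Fix integers $p,q\ge 0$. For each $n$ there are $n$ units; $T_i\in\{0,1\}$ is the treatment assignment of unit $i$ ($T_i=1$ for treatment 1, $T_i=0$ for treatment 2), possibly depending on $n$, and $\bm{x}_i=(x_{i,1},\dots,x_{i,p+q})^t$ is its covariate vector. The vectors $\bm{x}_i$ are i.i.d. over $i$; $x_{i,j}$ is distributed as $X_j$, the covariates $X_1,\dots,X_{p+q}$ are independent of each other, with $\mathbb{E}X_j=0$ and $0<\mathrm{Var}(X_j)<\infty$. The outcomes follow the true linear model $$Y_i=\mu_1T_i+\mu_2(1-T_i)+\sum_{j=1}^{p+q}\beta_jx_{i,j}+\epsilon_i,$$ where $\epsilon_1,\dots,\epsilon_n$ are i.i.d. with mean $0$ and variance $\sigma_\epsilon^2\in(0,\infty)$, independent of the covariates. The randomization uses only covariate information (and possibly extra external randomness), not the responses: $(T_1,\dots,T_n)$ and all covariates are jointly independent of $\bm{\epsilon}=(\epsilon_1,\dots,\epsilon_n)^t$. Working model. Only the first $p$ covariates are included: $\mathbb{E}[Y_i]=\mu_1T_i+\mu_2(1-T_i)+\sum_{j=1}^p\beta_jx_{i,j}$. Write $\bm{Y}=(Y_1,\dots,Y_n)^t$, $\bm{T}=(T_1,\dots,T_n)^t$, $\mathbf{X}_{\mathrm{in}}=(x_{i,j})_{1\le i\le n,1\le j\le p}$, $\mathbf{X}_{\mathrm{ex}}=(x_{i,p+j})_{1\le i\le n,1\le j\le q}$, $\bm{\beta}_{\mathrm{in}}=(\beta_1,\dots,\beta_p)^t$, $\bm{\beta}_{\mathrm{ex}}=(\beta_{p+1},\dots,\beta_{p+q})^t$,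 $\bm{1}_n$ the vector of $n$ ones, $\mathbf{G}=[\bm{T};\bm{1}_n-\bm{T};\mathbf{X}_{\mathrm{in}}]$ (an $n\times(p+2)$ matrix, columns juxtaposed), and $\bm{\theta}=(\mu_1,\mu_2,\bm{\beta}_{\mathrm{in}}^t)^t$. The OLS estimator is $\hat{\bm{\theta}}=(\mathbf{G}^t\mathbf{G})^{-1}\mathbf{G}^t\bm{Y}$ (defined arbitrarily when $\mathbf{G}^t\mathbf{G}$ is singular). *)

theory Defs
  imports
    "HOL-Probability.Probability"
    "Jordan_Normal_Form.Gauss_Jordan_Elimination"
begin

no_notation Finite_Cartesian_Product.vec_nth (infixl \<open>$\<close> 90)

hide_type (open) Finite_Cartesian_Product.vec


text \<open>
  The \<open>n\<close>-th term of a sequence of random variables lives on its own probability space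
  \<open>M n\<close>; a constant family \<open>M\<close> gives the situation of one common space.
\<close>

definition tendsto_in_prob ::
  "(nat \<Rightarrow> 'a measure) \<Rightarrow> (nat \<Rightarrow> 'a \<Rightarrow> real) \<Rightarrow> real \<Rightarrow> bool" where
  "tendsto_in_prob M Z c \<longleftrightarrow>
     (\<forall>n. Z n \<in> borel_measurable (M n)) \<and>
     (\<forall>\<delta>>0. (\<lambda>n. measure (M n) {\<omega> \<in> space (M n). \<bar>Z n \<omega> - c\<bar> > \<delta>}) \<longlonglongrightarrow> 0)"

definition eucl_norm :: "real vec \<Rightarrow> real" where
  "eucl_norm v = sqrt (v \<bullet> v)"

definition tendsto_in_prob_vec ::
  "(nat \<Rightarrow> 'a measure) \<Rightarrow> (nat \<Rightarrow> 'a \<Rightarrow> real vec) \<Rightarrow> real vec \<Rightarrow> bool" where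
  "tendsto_in_prob_vec M Z c \<longleftrightarrow> tendsto_in_prob M (\<lambda>n \<omega>. eucl_norm (Z n \<omega> - c)) 0"

definition little_o_P_1 :: "nat \<Rightarrow> (nat \<Rightarrow> 'a measure) \<Rightarrow> (nat \<Rightarrow> 'a \<Rightarrow> real vec) \<Rightarrow> bool" where
  "little_o_P_1 d M R \<longleftrightarrow> tendsto_in_prob_vec M R (0\<^sub>v d)"

text \<open>
  Convergence in distribution of \<open>d\<close>-dimensional random vectors, by bounded continuous test
  functions. A vector is a function \<open>nat \<Rightarrow> real\<close> of which only the coordinates below \<open>d\<close> matter;
  the space of dimension \<open>d\<close> is \<^term>\<open>powertop_real {..<d}\<close>.
\<close>

definition tendsto_in_distr ::
  "nat \<Rightarrow> (nat \<Rightarrow> 'a measure) \<Rightarrow> (nat \<Rightarrow> nat \<Rightarrow> 'a \<Rightarrow> real) \<Rightarrow> 'c measure \<Rightarrow> (nat \<Rightarrow> 'c \<Rightarrow> real) \<Rightarrow> bool"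
  where
  "tendsto_in_distr d M Z L \<xi> \<longleftrightarrow>
     (\<forall>f. continuous_map (powertop_real {..<d}) euclideanreal f \<and>
          bounded (f ` topspace (powertop_real {..<d})) \<longrightarrow>
          (\<lambda>n. \<integral>\<omega>. f (\<lambda>j\<in>{..<d}. Z n j \<omega>) \<partial>M n) \<longlonglongrightarrow> (\<integral>\<omega>. f (\<lambda>j\<in>{..<d}. \<xi> j \<omega>) \<partial>L))"


text \<open>\<open>prob_space.indep_var\<close> without its restriction to random variables of equal range type.\<close>

definition indep_var_het ::
  "'a measure \<Rightarrow> 'b measure \<Rightarrow> ('a \<Rightarrow> 'b) \<Rightarrow> 'c measure \<Rightarrow> ('a \<Rightarrow> 'c) \<Rightarrow> bool" where
  "indep_var_het M S U R V \<longleftrightarrow>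
     U \<in> M \<rightarrow>\<^sub>M S \<and> V \<in> M \<rightarrow>\<^sub>M R \<and>
     prob_space.indep_set M {U -` A \<inter> space M |A. A \<in> sets S} {V -` B \<inter> space M |B. B \<in> sets R}"


text \<open>
  Units and covariates are numbered from \<open>0\<close>: unit \<open>i < n\<close>, covariate \<open>j < p + q\<close>, and the
  covariates \<open>j < p\<close> are the ones in the working model. All data may depend on \<open>n\<close>. The variables
  \<open>X j\<close>, on a space \<open>N\<close> of their own, carry the common law of the covariates.
\<close>

locale covariate_adaptive_setting =
  fixes p q :: nat
    and M :: "nat \<Rightarrow> 'a measure"
    and T :: "nat \<Rightarrow> nat \<Rightarrow> 'a \<Rightarrow> real"
    and x :: "nat \<Rightarrow> nat \<Rightarrow> nat \<Rightarrow> 'a \<Rightarrow> real"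
    and \<epsilon> :: "nat \<Rightarrow> nat \<Rightarrow> 'a \<Rightarrow> real"
    and N :: "'b measure"
    and X :: "nat \<Rightarrow> 'b \<Rightarrow> real"
    and \<sigma> :: real
  assumes prob_M: "prob_space (M n)"
    and prob_N: "prob_space N"
    and T_measurable: "i < n \<Longrightarrow> T n i \<in> borel_measurable (M n)"
    and T_binary: "i < n \<Longrightarrow> \<omega> \<in> space (M n) \<Longrightarrow> T n i \<omega> \<in> {0, 1}"
    and X_indep: "prob_space.indep_vars N (\<lambda>_. borel) X {..<p + q}"
    and X_square_integrable: "j < p + q \<Longrightarrow> integrable N (\<lambda>w. (X j w)\<^sup>2)"
    and X_mean: "j < p + q \<Longrightarrow> prob_space.expectation N (X j) = 0"
    and X_variance: "j < p + q \<Longrightarrow> prob_space.variance N (X j) > 0"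
    and x_indep: "prob_space.indep_vars (M n) (\<lambda>_. \<Pi>\<^sub>M j\<in>{..<p + q}. borel)
                    (\<lambda>i \<omega>. \<lambda>j\<in>{..<p + q}. x n i j \<omega>) {..<n}"
    and x_distr: "i < n \<Longrightarrow>
                    distr (M n) (\<Pi>\<^sub>M j\<in>{..<p + q}. borel) (\<lambda>\<omega>. \<lambda>j\<in>{..<p + q}. x n i j \<omega>) =
                    distr N (\<Pi>\<^sub>M j\<in>{..<p + q}. borel) (\<lambda>w. \<lambda>j\<in>{..<p + q}. X j w)"
    and \<sigma>_pos: "\<sigma> > 0"
    and \<epsilon>_indep: "prob_space.indep_vars (M n) (\<lambda>_. borel) (\<epsilon> n) {..<n}"
    and \<epsilon>_ident: "i < n \<Longrightarrow> k < m \<Longrightarrow> distr (M n) borel (\<epsilon> n i) = distr (M m) borel (\<epsilon> m k)"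
    and \<epsilon>_square_integrable: "i < n \<Longrightarrow> integrable (M n) (\<lambda>\<omega>. (\<epsilon> n i \<omega>)\<^sup>2)"
    and \<epsilon>_mean: "i < n \<Longrightarrow> prob_space.expectation (M n) (\<epsilon> n i) = 0"
    and \<epsilon>_variance: "i < n \<Longrightarrow> prob_space.variance (M n) (\<epsilon> n i) = \<sigma>\<^sup>2"
    and design_indep_\<epsilon>:
      "indep_var_het (M n)
         ((\<Pi>\<^sub>M i\<in>{..<n}. borel) \<Otimes>\<^sub>M (\<Pi>\<^sub>M i\<in>{..<n}. \<Pi>\<^sub>M j\<in>{..<p + q}. borel))
         (\<lambda>\<omega>. (\<lambda>i\<in>{..<n}. T n i \<omega>, \<lambda>i\<in>{..<n}. \<lambda>j\<in>{..<p + q}. x n i j \<omega>))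
         (\<Pi>\<^sub>M i\<in>{..<n}. borel)
         (\<lambda>\<omega>. \<lambda>i\<in>{..<n}. \<epsilon> n i \<omega>)"


text \<open>The arguments of the following functions are realised values, for a fixed \<open>n\<close> and outcome.\<close>

definition response ::
  "nat \<Rightarrow> real \<Rightarrow> real \<Rightarrow> (nat \<Rightarrow> real) \<Rightarrow> nat \<Rightarrow> (nat \<Rightarrow> real) \<Rightarrow> (nat \<Rightarrow> nat \<Rightarrow> real) \<Rightarrow> (nat \<Rightarrow> real) \<Rightarrow> real vec"
  where
  "response d \<mu>1 \<mu>2 \<beta> n t x e =
     Matrix.vec n (\<lambda>i. \<mu>1 * t i + \<mu>2 * (1 - t i) + (\<Sum>j<d. \<beta> j * x i j) + e i)"

definition X_in :: "nat \<Rightarrow> nat \<Rightarrow> (nat \<Rightarrow> nat \<Rightarrow> real) \<Rightarrow> real mat" where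
  "X_in p n x = Matrix.mat n p (\<lambda>(i, j). x i j)"

definition X_ex :: "nat \<Rightarrow> nat \<Rightarrow> nat \<Rightarrow> (nat \<Rightarrow> nat \<Rightarrow> real) \<Rightarrow> real mat" where
  "X_ex p q n x = Matrix.mat n q (\<lambda>(i, j). x i (p + j))"

definition \<beta>_in :: "nat \<Rightarrow> (nat \<Rightarrow> real) \<Rightarrow> real vec" where
  "\<beta>_in p \<beta> = Matrix.vec p \<beta>"

definition \<beta>_ex :: "nat \<Rightarrow> nat \<Rightarrow> (nat \<Rightarrow> real) \<Rightarrow> real vec" where
  "\<beta>_ex p q \<beta> = Matrix.vec q (\<lambda>j. \<beta> (p + j))"

definition design_mat :: "nat \<Rightarrow> nat \<Rightarrow> (nat \<Rightarrow> real) \<Rightarrow> (nat \<Rightarrow> nat \<Rightarrow> real) \<Rightarrow> real mat" where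
  "design_mat p n t x =
     mat_of_cols n ([Matrix.vec n t, Matrix.vec n (\<lambda>_. 1) - Matrix.vec n t] @ cols (X_in p n x))"

definition true_param :: "nat \<Rightarrow> real \<Rightarrow> real \<Rightarrow> (nat \<Rightarrow> real) \<Rightarrow> real vec" where
  "true_param p \<mu>1 \<mu>2 \<beta> = vec_of_list [\<mu>1, \<mu>2] @\<^sub>v \<beta>_in p \<beta>"

definition limit_mat :: "nat \<Rightarrow> 'b measure \<Rightarrow> (nat \<Rightarrow> 'b \<Rightarrow> real) \<Rightarrow> real mat" where
  "limit_mat p N X =
     mat_diag (p + 2) (\<lambda>k. if k < 2 then 1 / 2 else prob_space.variance N (X (k - 2)))"

text \<open>Only meaningful for invertible matrices.\<close>

definition inv_mat :: "real mat \<Rightarrow> real mat" where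
  "inv_mat A = the (mat_inverse A)"

text \<open>Nothing is required of the estimate when the Gram matrix is singular.\<close>

definition is_ols_estimate :: "real mat \<Rightarrow> real vec \<Rightarrow> real vec \<Rightarrow> bool" where
  "is_ols_estimate G y \<theta> \<longleftrightarrow>
     (invertible_mat (G\<^sup>T * G) \<longrightarrow> \<theta> = inv_mat (G\<^sup>T * G) *\<^sub>v (G\<^sup>T *\<^sub>v y))"

end

(*
With A = G^t G / n and b = G^t (X_ex beta_ex + eps) / sqrt n, the scaled error u = sqrt n (theta_hat - theta)
solves A u = b wherever A is invertible. Writing T = 1/2 + (2T - 1)/2 and 1 - T = 1/2 - (2T - 1)/2, global
and covariate balance reduce the entries of A to balance terms and covariate averages, so A tends to V in
probability; only the squares of the covariates need a law of large numbers under a mere first moment, hence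
truncation. The same decomposition shows that b is bounded in probability: covariate balance converges in
distribution and is therefore tight, and the remaining sums are uncorrelated with bounded second moments.
Where A is close to V it is invertible, and u - V^(-1) b is at most a constant times |A - V| |b|.
*)

theory Submission
  imports Defs "HOL-Real_Asymp.Real_Asymp" "Jordan_Normal_Form.Determinant"
begin

section \<open>Convergence and boundedness in probability\<close>

text \<open>\<open>bounded_in_prob\<close> is the usual O_P(1), asked only for large n, since a
  limit of expectations says nothing about small n. All limits are in probability: data for
  different n may live on unrelated spaces, so pathwise limits have no meaning. The obstacle is that
  an assignment may depend on all covariates at once, so a sum involving T is not a sum of
  independent terms. Against covariates it is controlled through the balance assumptions; against
  the noise, through the independence of the noise from the design as a whole. Independence between
  covariates keeps the omitted ones from biasing the estimate: a product of two different covariates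
  has mean zero and, the squares being independent too, a finite second moment. Sizes of vectors and
  matrices are measured by sums of absolute entries, which turns the inversion of the Gram matrix
  into an absorption argument on finite sums.\<close>

definition bounded_in_prob :: "(nat \<Rightarrow> 'a measure) \<Rightarrow> (nat \<Rightarrow> 'a \<Rightarrow> real) \<Rightarrow> bool" where
  "bounded_in_prob M Z \<longleftrightarrow>
     (\<forall>n. Z n \<in> borel_measurable (M n)) \<and>
     (\<forall>\<delta>>0. \<exists>K>0. \<forall>\<^sub>F n in sequentially. measure (M n) {\<omega> \<in> space (M n). \<bar>Z n \<omega>\<bar> > K} \<le> \<delta>)"

lemma tendsto_in_prob_measurable:
  "tendsto_in_prob M Z c \<Longrightarrow> Z n \<in> borel_measurable (M n)"
  by (simp add: tendsto_in_prob_def)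

lemma tendsto_in_prob_ev:
  assumes "tendsto_in_prob M Z c" "\<delta> > 0" "\<eta> > 0"
  shows "\<forall>\<^sub>F n in sequentially. measure (M n) {\<omega> \<in> space (M n). \<bar>Z n \<omega> - c\<bar> > \<delta>} \<le> \<eta>"
proof -
  have "(\<lambda>n. measure (M n) {\<omega> \<in> space (M n). \<bar>Z n \<omega> - c\<bar> > \<delta>}) \<longlonglongrightarrow> 0"
    using assms unfolding tendsto_in_prob_def by simp
  from order_tendstoD(2)[OF this \<open>\<eta> > 0\<close>] show ?thesis
    by (rule eventually_mono) simp
qed

lemma bounded_in_prob_measurable:
  "bounded_in_prob M Z \<Longrightarrow> Z n \<in> borel_measurable (M n)"
  by (simp add: bounded_in_prob_def)

lemma bounded_in_probE:
  assumes "bounded_in_prob M Z" "\<delta> > 0"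
  obtains K where "K > 0"
    "\<forall>\<^sub>F n in sequentially. measure (M n) {\<omega> \<in> space (M n). \<bar>Z n \<omega>\<bar> > K} \<le> \<delta>"
  using assms unfolding bounded_in_prob_def by blast

locale prob_seq =
  fixes M :: "nat \<Rightarrow> 'a measure"
  assumes prob_space_M: "prob_space (M n)"
begin

lemma tendsto_in_probI:
  assumes "\<And>n. Z n \<in> borel_measurable (M n)"
    and "\<And>\<delta> \<eta>. \<delta> > 0 \<Longrightarrow> \<eta> > 0 \<Longrightarrow>
      \<forall>\<^sub>F n in sequentially. measure (M n) {\<omega> \<in> space (M n). \<bar>Z n \<omega> - c\<bar> > \<delta>} \<le> \<eta>"
  shows "tendsto_in_prob M Z c"
  unfolding tendsto_in_prob_def
proof (intro conjI allI impI assms(1))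
  fix \<delta> :: real assume \<delta>: "\<delta> > 0"
  show "(\<lambda>n. measure (M n) {\<omega> \<in> space (M n). \<bar>Z n \<omega> - c\<bar> > \<delta>}) \<longlonglongrightarrow> 0"
  proof (rule order_tendstoI)
    fix a :: real assume "a < 0"
    then show "\<forall>\<^sub>F n in sequentially. a < measure (M n) {\<omega> \<in> space (M n). \<bar>Z n \<omega> - c\<bar> > \<delta>}"
      by (intro always_eventually allI) (rule less_le_trans[OF _ measure_nonneg])
  next
    fix a :: real assume "a > 0"
    with assms(2)[OF \<delta>, of "a/2"]
    show "\<forall>\<^sub>F n in sequentially. measure (M n) {\<omega> \<in> space (M n). \<bar>Z n \<omega> - c\<bar> > \<delta>} < a"
      by (auto elim!: eventually_mono)
  qed
qed

text \<open>The union bound behind all the rules below. Measurability is asked of \<open>P\<close>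
  and \<open>Q\<close> alone, because monotonicity of the measure wants it only for the larger
  set.\<close>

lemma measure_le_add:
  assumes [measurable]: "Measurable.pred (M n) P" "Measurable.pred (M n) Q"
    and "\<And>\<omega>. \<omega> \<in> space (M n) \<Longrightarrow> R \<omega> \<Longrightarrow> P \<omega> \<or> Q \<omega>"
    and "measure (M n) {\<omega> \<in> space (M n). P \<omega>} \<le> a"
    and "measure (M n) {\<omega> \<in> space (M n). Q \<omega>} \<le> b"
  shows "measure (M n) {\<omega> \<in> space (M n). R \<omega>} \<le> a + b"
proof -
  interpret prob_space "M n" by (rule prob_space_M)
  have "measure (M n) {\<omega> \<in> space (M n). R \<omega>} \<le>
    measure (M n) ({\<omega> \<in> space (M n). P \<omega>} \<union> {\<omega> \<in> space (M n). Q \<omega>})"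
    using assms(3) by (intro finite_measure_mono) auto
  also have "\<dots> \<le> measure (M n) {\<omega> \<in> space (M n). P \<omega>} + measure (M n) {\<omega> \<in> space (M n). Q \<omega>}"
    by (intro measure_Un_le) auto
  finally show ?thesis using assms(4,5) by linarith
qed

lemma tendsto_in_prob_of_tendsto:
  assumes "a \<longlonglongrightarrow> c"
  shows "tendsto_in_prob M (\<lambda>n \<omega>. a n) c"
proof (rule tendsto_in_probI)
  fix \<delta> \<eta> :: real assume "\<delta> > 0" "\<eta> > 0"
  from tendstoD[OF assms \<open>\<delta> > 0\<close>] 
  show "\<forall>\<^sub>F n in sequentially. measure (M n) {\<omega> \<in> space (M n). \<bar>a n - c\<bar> > \<delta>} \<le> \<eta>"
    by eventually_elim (use \<open>\<eta> > 0\<close> in \<open>auto simp: dist_real_def\<close>)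
qed auto

text \<open>The domination may fail where \<open>V\<close> exceeds \<open>c\<close>, an event of
  vanishing probability. This is how a deterministic estimate valid only for a nearly diagonal Gram
  matrix becomes a limit in probability.\<close>

lemma tendsto_in_prob_0_dominated:
  assumes Z[measurable]: "\<And>n. Z n \<in> borel_measurable (M n)"
    and U: "tendsto_in_prob M U 0" and V: "tendsto_in_prob M V 0" and "c > 0"
    and le: "\<forall>\<^sub>F n in sequentially. \<forall>\<omega>\<in>space (M n). V n \<omega> \<le> c \<longrightarrow> \<bar>Z n \<omega>\<bar> \<le> U n \<omega>"
  shows "tendsto_in_prob M Z 0"
proof (rule tendsto_in_probI[OF Z])
  fix \<delta> \<eta> :: real assume "\<delta> > 0" "\<eta> > 0"
  note [measurable] = tendsto_in_prob_measurable[OF U] tendsto_in_prob_measurable[OF V]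
  from tendsto_in_prob_ev[OF U \<open>\<delta> > 0\<close>, of "\<eta>/2"] tendsto_in_prob_ev[OF V \<open>c > 0\<close>, of "\<eta>/2"] \<open>\<eta> > 0\<close>
  have "\<forall>\<^sub>F n in sequentially. measure (M n) {\<omega> \<in> space (M n). \<bar>U n \<omega> - 0\<bar> > \<delta>} \<le> \<eta>/2"
    "\<forall>\<^sub>F n in sequentially. measure (M n) {\<omega> \<in> space (M n). \<bar>V n \<omega> - 0\<bar> > c} \<le> \<eta>/2" by auto
  with le show "\<forall>\<^sub>F n in sequentially. measure (M n) {\<omega> \<in> space (M n). \<bar>Z n \<omega> - 0\<bar> > \<delta>} \<le> \<eta>"
  proof eventually_elim
    case (elim n)
    have "measure (M n) {\<omega> \<in> space (M n). \<bar>Z n \<omega> - 0\<bar> > \<delta>} \<le> \<eta>/2 + \<eta>/2"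
      by (rule measure_le_add[OF _ _ _ elim(2,3)]) (use elim(1) in fastforce)+
    then show ?case by simp
  qed
qed

lemma tendsto_in_prob_add:
  assumes U: "tendsto_in_prob M U a" and V: "tendsto_in_prob M V b"
  shows "tendsto_in_prob M (\<lambda>n \<omega>. U n \<omega> + V n \<omega>) (a + b)"
proof (rule tendsto_in_probI)
  note [measurable] = tendsto_in_prob_measurable[OF U] tendsto_in_prob_measurable[OF V]
  show "(\<lambda>\<omega>. U n \<omega> + V n \<omega>) \<in> borel_measurable (M n)" for n by simp
  fix \<delta> \<eta> :: real assume "\<delta> > 0" "\<eta> > 0"
  from tendsto_in_prob_ev[OF U, of "\<delta>/2" "\<eta>/2"] tendsto_in_prob_ev[OF V, of "\<delta>/2" "\<eta>/2"] \<open>\<eta> > 0\<close> \<open>\<delta> > 0\<close>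
  have "\<forall>\<^sub>F n in sequentially. measure (M n) {\<omega> \<in> space (M n). \<bar>U n \<omega> - a\<bar> > \<delta>/2} \<le> \<eta>/2"
    "\<forall>\<^sub>F n in sequentially. measure (M n) {\<omega> \<in> space (M n). \<bar>V n \<omega> - b\<bar> > \<delta>/2} \<le> \<eta>/2" by auto
  then show "\<forall>\<^sub>F n in sequentially. measure (M n) {\<omega> \<in> space (M n). \<bar>U n \<omega> + V n \<omega> - (a + b)\<bar> > \<delta>} \<le> \<eta>"
  proof eventually_elim
    case (elim n)
    have "measure (M n) {\<omega> \<in> space (M n). \<bar>U n \<omega> + V n \<omega> - (a + b)\<bar> > \<delta>} \<le> \<eta>/2 + \<eta>/2"
      by (rule measure_le_add[OF _ _ _ elim]) (measurable, arith)
    then show ?case by simp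
  qed
qed

text \<open>The rule o_P(1) O_P(1) = o_P(1): outside an event of probability about \<eta>/2 the
  factor \<open>V\<close> is at most \<open>K\<close>, and there it suffices that \<open>U\<close>
  is at most \<delta>/K.\<close>

lemma tendsto_in_prob_0_mult_bounded:
  assumes U: "tendsto_in_prob M U 0" and V: "bounded_in_prob M V"
  shows "tendsto_in_prob M (\<lambda>n \<omega>. U n \<omega> * V n \<omega>) 0"
proof (rule tendsto_in_probI)
  note [measurable] = tendsto_in_prob_measurable[OF U] bounded_in_prob_measurable[OF V]
  show "(\<lambda>\<omega>. U n \<omega> * V n \<omega>) \<in> borel_measurable (M n)" for n by simp
  fix \<delta> \<eta> :: real assume "\<delta> > 0" "\<eta> > 0"
  then have "\<eta>/2 > 0" by simp
  obtain K where "K > 0" and K: "\<forall>\<^sub>F n in sequentially. measure (M n) {\<omega> \<in> space (M n). \<bar>V n \<omega>\<bar> > K} \<le> \<eta>/2"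
    using bounded_in_probE[OF V \<open>\<eta>/2 > 0\<close>] .
  have "\<delta>/K > 0" using \<open>\<delta> > 0\<close> \<open>K > 0\<close> by simp
  from tendsto_in_prob_ev[OF U this \<open>\<eta>/2 > 0\<close>] K
  show "\<forall>\<^sub>F n in sequentially. measure (M n) {\<omega> \<in> space (M n). \<bar>U n \<omega> * V n \<omega> - 0\<bar> > \<delta>} \<le> \<eta>"
  proof eventually_elim
    case (elim n)
    have *: "\<bar>U n \<omega> * V n \<omega>\<bar> \<le> \<delta>" if "\<bar>U n \<omega>\<bar> \<le> \<delta>/K" "\<bar>V n \<omega>\<bar> \<le> K" for \<omega>
      using mult_mono[OF that] \<open>K > 0\<close> \<open>\<delta> > 0\<close> by (simp add: abs_mult)
    have "measure (M n) {\<omega> \<in> space (M n). \<bar>U n \<omega> * V n \<omega> - 0\<bar> > \<delta>} \<le> \<eta>/2 + \<eta>/2"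
      by (rule measure_le_add[OF _ _ _ elim]) (measurable, use * in \<open>force simp: not_le[symmetric]\<close>)
    then show ?case by simp
  qed
qed

lemma bounded_in_prob_const: "bounded_in_prob M (\<lambda>n \<omega>. c)"
  unfolding bounded_in_prob_def
  by (intro conjI allI impI exI[of _ "\<bar>c\<bar> + 1"]) auto

lemma bounded_in_prob_add:
  assumes U: "bounded_in_prob M U" and V: "bounded_in_prob M V"
  shows "bounded_in_prob M (\<lambda>n \<omega>. U n \<omega> + V n \<omega>)"
  unfolding bounded_in_prob_def
proof (intro conjI allI impI)
  note [measurable] = bounded_in_prob_measurable[OF U] bounded_in_prob_measurable[OF V]
  show "(\<lambda>\<omega>. U n \<omega> + V n \<omega>) \<in> borel_measurable (M n)" for n by simp
  fix \<delta> :: real assume "\<delta> > 0"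
  then have "\<delta>/2 > 0" by simp
  obtain K where "K > 0" and K: "\<forall>\<^sub>F n in sequentially. measure (M n) {\<omega> \<in> space (M n). \<bar>U n \<omega>\<bar> > K} \<le> \<delta>/2"
    using bounded_in_probE[OF U \<open>\<delta>/2 > 0\<close>] .
  obtain J where "J > 0" and J: "\<forall>\<^sub>F n in sequentially. measure (M n) {\<omega> \<in> space (M n). \<bar>V n \<omega>\<bar> > J} \<le> \<delta>/2"
    using bounded_in_probE[OF V \<open>\<delta>/2 > 0\<close>] .
  have "\<forall>\<^sub>F n in sequentially. measure (M n) {\<omega> \<in> space (M n). \<bar>U n \<omega> + V n \<omega>\<bar> > K + J} \<le> \<delta>"
    using K J
  proof eventually_elim
    case (elim n)
    have "measure (M n) {\<omega> \<in> space (M n). \<bar>U n \<omega> + V n \<omega>\<bar> > K + J} \<le> \<delta>/2 + \<delta>/2"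
      by (rule measure_le_add[OF _ _ _ elim]) (measurable, arith)
    then show ?case by simp
  qed
  then show "\<exists>K>0. \<forall>\<^sub>F n in sequentially. measure (M n) {\<omega> \<in> space (M n). \<bar>U n \<omega> + V n \<omega>\<bar> > K} \<le> \<delta>"
    using \<open>K > 0\<close> \<open>J > 0\<close> by (intro exI[of _ "K + J"]) auto
qed

lemma bounded_in_prob_dominated:
  assumes [measurable]: "\<And>n. U n \<in> borel_measurable (M n)" and V: "bounded_in_prob M V"
    and le: "\<And>n \<omega>. \<omega> \<in> space (M n) \<Longrightarrow> \<bar>U n \<omega>\<bar> \<le> c * \<bar>V n \<omega>\<bar>"
  shows "bounded_in_prob M U"
  unfolding bounded_in_prob_def
proof (intro conjI allI impI)
  note [measurable] = bounded_in_prob_measurable[OF V]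
  fix \<delta> :: real assume "\<delta> > 0"
  obtain K where "K > 0" and K: "\<forall>\<^sub>F n in sequentially. measure (M n) {\<omega> \<in> space (M n). \<bar>V n \<omega>\<bar> > K} \<le> \<delta>"
    using bounded_in_probE[OF V \<open>\<delta> > 0\<close>] .
  \<comment> \<open>Adding 1 keeps the new bound positive for every \<open>c\<close>, as
    \<open>bounded_in_prob\<close> demands.\<close>
  let ?J = "(\<bar>c\<bar> + 1) * K"
  have "\<forall>\<^sub>F n in sequentially. measure (M n) {\<omega> \<in> space (M n). \<bar>U n \<omega>\<bar> > ?J} \<le> \<delta>"
    using K
  proof eventually_elim
    case (elim n)
    interpret prob_space "M n" by (rule prob_space_M)
    have "\<bar>V n \<omega>\<bar> > K" if "\<omega> \<in> space (M n)" "\<bar>U n \<omega>\<bar> > ?J" for \<omega>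
    proof (rule ccontr)
      assume "\<not> \<bar>V n \<omega>\<bar> > K"
      then have "c * \<bar>V n \<omega>\<bar> \<le> (\<bar>c\<bar> + 1) * K" by (intro mult_mono) auto
      with le[OF that(1)] that(2) show False by linarith
    qed
    then have "measure (M n) {\<omega> \<in> space (M n). \<bar>U n \<omega>\<bar> > ?J} \<le> measure (M n) {\<omega> \<in> space (M n). \<bar>V n \<omega>\<bar> > K}"
      by (intro finite_measure_mono) auto
    with elim show ?case by linarith
  qed
  then show "\<exists>K>0. \<forall>\<^sub>F n in sequentially. measure (M n) {\<omega> \<in> space (M n). \<bar>U n \<omega>\<bar> > K} \<le> \<delta>"
    using \<open>K > 0\<close> by (intro exI[of _ ?J]) auto
qed auto

lemma bounded_in_prob_cmult:
  assumes "bounded_in_prob M U"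
  shows "bounded_in_prob M (\<lambda>n \<omega>. c * U n \<omega>)"
  using bounded_in_prob_measurable[OF assms]
  by (intro bounded_in_prob_dominated[OF _ assms, of _ "\<bar>c\<bar>"]) (auto simp: abs_mult)

lemma bounded_in_prob_abs:
  assumes "bounded_in_prob M U"
  shows "bounded_in_prob M (\<lambda>n \<omega>. \<bar>U n \<omega>\<bar>)"
  using bounded_in_prob_measurable[OF assms]
  by (intro bounded_in_prob_dominated[OF _ assms, of _ 1]) auto

lemma bounded_in_prob_sum:
  assumes "\<And>k. k \<in> I \<Longrightarrow> bounded_in_prob M (U k)"
  shows "bounded_in_prob M (\<lambda>n \<omega>. \<Sum>k\<in>I. U k n \<omega>)"
  using assms
\<comment> \<open>Over an infinite set the sum is 0 by convention, so the induction covers every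
  \<open>I\<close>.\<close>
proof (induction I rule: infinite_finite_induct)
  case (insert k I)
  then show ?case
    using bounded_in_prob_add[of "U k" "\<lambda>n \<omega>. \<Sum>k\<in>I. U k n \<omega>"] by simp
qed (simp_all add: bounded_in_prob_const)

lemma tendsto_in_prob_cmult:
  assumes "tendsto_in_prob M U a"
  shows "tendsto_in_prob M (\<lambda>n \<omega>. c * U n \<omega>) (c * a)"
proof -
  \<comment> \<open>The product rule is available for limit 0, so the limit is subtracted first and
    added back after scaling.\<close>
  have "tendsto_in_prob M (\<lambda>n \<omega>. U n \<omega> + (-a)) (a + (-a))"
    by (intro tendsto_in_prob_add assms tendsto_in_prob_of_tendsto tendsto_const)
  then have "tendsto_in_prob M (\<lambda>n \<omega>. U n \<omega> + (-a)) 0" by simp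
  then have "tendsto_in_prob M (\<lambda>n \<omega>. (U n \<omega> + (-a)) * c) 0"
    by (rule tendsto_in_prob_0_mult_bounded[OF _ bounded_in_prob_const])
  from tendsto_in_prob_add[OF this tendsto_in_prob_of_tendsto[OF tendsto_const[of "c * a"]]]
  show ?thesis by (simp add: algebra_simps)
qed

lemma tendsto_in_prob_0_abs:
  assumes "tendsto_in_prob M U 0"
  shows "tendsto_in_prob M (\<lambda>n \<omega>. \<bar>U n \<omega>\<bar>) 0"
  using assms unfolding tendsto_in_prob_def by (simp add: borel_measurable_abs)

lemma tendsto_in_prob_sum:
  assumes "\<And>k. k \<in> I \<Longrightarrow> tendsto_in_prob M (U k) (a k)"
  shows "tendsto_in_prob M (\<lambda>n \<omega>. \<Sum>k\<in>I. U k n \<omega>) (\<Sum>k\<in>I. a k)"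
  using assms
proof (induction I rule: infinite_finite_induct)
  case (insert k I)
  then show ?case
    using tendsto_in_prob_add[of "U k" "a k" "\<lambda>n \<omega>. \<Sum>k\<in>I. U k n \<omega>"] by simp
qed (simp_all add: tendsto_in_prob_of_tendsto)

text \<open>Identities that cancel \<open>real n\<close> or \<open>sqrt (real n)\<close> fail at n =
  0, where division yields 0; agreement for large n is what can be supplied.\<close>

lemma tendsto_in_prob_cong_eventually:
  assumes "tendsto_in_prob M U a" "\<And>n. V n \<in> borel_measurable (M n)"
    and "\<forall>\<^sub>F n in sequentially. \<forall>\<omega>\<in>space (M n). U n \<omega> = V n \<omega>"
  shows "tendsto_in_prob M V a"
proof (rule tendsto_in_probI[OF assms(2)])
  fix \<delta> \<eta> :: real assume "\<delta> > 0" "\<eta> > 0"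
  from tendsto_in_prob_ev[OF assms(1) this] assms(3)
  show "\<forall>\<^sub>F n in sequentially. measure (M n) {\<omega> \<in> space (M n). \<bar>V n \<omega> - a\<bar> > \<delta>} \<le> \<eta>"
  proof eventually_elim
    case (elim n)
    then have "{\<omega> \<in> space (M n). \<bar>V n \<omega> - a\<bar> > \<delta>} = {\<omega> \<in> space (M n). \<bar>U n \<omega> - a\<bar> > \<delta>}"
      by (intro Collect_cong conj_cong) simp_all
    with elim(1) show ?case by (simp only:)
  qed
qed

text \<open>Applied to a sum already divided by the root of n, this turns a root-n bound into a law
  of large numbers with limit 0.\<close>

lemma tendsto_in_prob_0_of_bounded:
  assumes "bounded_in_prob M U"
  shows "tendsto_in_prob M (\<lambda>n \<omega>. U n \<omega> / sqrt (real n)) 0"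
proof -
  have "(\<lambda>n. 1 / sqrt (real n)) \<longlonglongrightarrow> 0"
    by real_asymp
  from tendsto_in_prob_0_mult_bounded[OF tendsto_in_prob_of_tendsto[OF this] assms]
  show ?thesis by simp
qed

text \<open>The Euclidean norm is at most the sum of the absolute coordinates. The vectors have
  dimension \<open>d\<close> only on the space of \<open>M n\<close>, so the norm is first replaced
  by an explicit coordinate sum, and measurability and convergence are carried back along equality
  on that space.\<close>

lemma tendsto_in_prob_vecI:
  assumes "\<And>n \<omega>. \<omega> \<in> space (M n) \<Longrightarrow> Z n \<omega> \<in> carrier_vec d" "c \<in> carrier_vec d"
    and "\<And>k. k < d \<Longrightarrow> tendsto_in_prob M (\<lambda>n \<omega>. Z n \<omega> $ k - c $ k) 0"
  shows "tendsto_in_prob_vec M Z c"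
proof -
  have sm: "(\<Sum>k<d. (Z n \<omega> $ k - c $ k)\<^sup>2) = (Z n \<omega> - c) \<bullet> (Z n \<omega> - c)" if "\<omega> \<in> space (M n)" for n \<omega>
  proof -
    have "dim_vec (Z n \<omega>) = d" "dim_vec c = d"
      using carrier_vecD[OF assms(1)[OF that]] carrier_vecD[OF assms(2)] .
    then show ?thesis
      by (simp add: scalar_prod_def power2_eq_square atLeast0LessThan)
  qed
  have meas: "(\<lambda>\<omega>. Z n \<omega> $ k - c $ k) \<in> borel_measurable (M n)" if "k < d" for n k
    using tendsto_in_prob_measurable[OF assms(3)[OF that]] .
  have le: "sqrt (\<Sum>k<d. (Z n \<omega> $ k - c $ k)\<^sup>2) \<le> (\<Sum>k<d. \<bar>Z n \<omega> $ k - c $ k\<bar>)" for n \<omega>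
    using L2_set_le_sum_abs[of "\<lambda>k. Z n \<omega> $ k - c $ k" "{..<d}"] by (simp add: L2_set_def)
  have "tendsto_in_prob M (\<lambda>n \<omega>. sqrt (\<Sum>k<d. (Z n \<omega> $ k - c $ k)\<^sup>2)) 0"
  \<comment> \<open>With \<open>V\<close> zero the domination is unconditional.\<close>
  proof (rule tendsto_in_prob_0_dominated[where V = "\<lambda>n \<omega>. 0" and c = 1])
    show "tendsto_in_prob M (\<lambda>n \<omega>. \<Sum>k<d. \<bar>Z n \<omega> $ k - c $ k\<bar>) 0"
      using tendsto_in_prob_sum[of "{..<d}" "\<lambda>k n \<omega>. \<bar>Z n \<omega> $ k - c $ k\<bar>" "\<lambda>_. 0"]
        tendsto_in_prob_0_abs[OF assms(3)] by simp
    show "(\<lambda>\<omega>. sqrt (\<Sum>k<d. (Z n \<omega> $ k - c $ k)\<^sup>2)) \<in> borel_measurable (M n)" for n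
      using meas by (intro measurable_compose[OF _ borel_measurable_sqrt] borel_measurable_sum borel_measurable_power) auto
  qed (auto intro!: tendsto_in_prob_of_tendsto always_eventually le simp: sum_nonneg)
  note t = this
  have eq: "sqrt (\<Sum>k<d. (Z n \<omega> $ k - c $ k)\<^sup>2) = eucl_norm (Z n \<omega> - c)" if "\<omega> \<in> space (M n)" for n \<omega>
    unfolding eucl_norm_def sm[OF that] ..
  have "(\<lambda>\<omega>. eucl_norm (Z n \<omega> - c)) \<in> borel_measurable (M n)" for n
    by (rule measurable_cong[OF eq, THEN iffD1], assumption) (rule tendsto_in_prob_measurable[OF t])
  moreover have "\<forall>\<^sub>F n in sequentially. \<forall>\<omega>\<in>space (M n).
      sqrt (\<Sum>k<d. (Z n \<omega> $ k - c $ k)\<^sup>2) = eucl_norm (Z n \<omega> - c)"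
    by (intro always_eventually allI ballI eq)
  ultimately show ?thesis
    unfolding tendsto_in_prob_vec_def by (rule tendsto_in_prob_cong_eventually[OF t])
qed

end

section \<open>Sums of uncorrelated and of independent variables\<close>

lemma integrable_mult_of_square:
  fixes f g :: "'b \<Rightarrow> real"
  assumes [measurable]: "f \<in> borel_measurable N" "g \<in> borel_measurable N"
    and f: "integrable N (\<lambda>x. (f x)\<^sup>2)" and g: "integrable N (\<lambda>x. (g x)\<^sup>2)"
  shows "integrable N (\<lambda>x. f x * g x)"
proof (rule Bochner_Integration.integrable_bound)
  show "integrable N (\<lambda>x. (f x)\<^sup>2 + (g x)\<^sup>2)" using f g by simp
  have "\<bar>a * b\<bar> \<le> a\<^sup>2 + b\<^sup>2" for a b :: real
  proof -
    have "2 * (\<bar>a\<bar> * \<bar>b\<bar>) \<le> a\<^sup>2 + b\<^sup>2"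
      using sum_squares_bound[of "\<bar>a\<bar>" "\<bar>b\<bar>"] by simp
    moreover have "0 \<le> \<bar>a\<bar> * \<bar>b\<bar>" by simp
    ultimately show ?thesis unfolding abs_mult by linarith
  qed
  then show "AE x in N. norm (f x * g x) \<le> norm ((f x)\<^sup>2 + (g x)\<^sup>2)" by simp
qed simp

lemma indep_vars_expectation_mult:
  fixes Z :: "nat \<Rightarrow> 'b \<Rightarrow> real"
  assumes "prob_space N" "prob_space.indep_vars N (\<lambda>_. borel) Z I"
    and "i \<in> I" "k \<in> I" "i \<noteq> k" and "integrable N (Z i)" "integrable N (Z k)"
  shows "(\<integral>\<omega>. Z i \<omega> * Z k \<omega> \<partial>N) = (\<integral>\<omega>. Z i \<omega> \<partial>N) * (\<integral>\<omega>. Z k \<omega> \<partial>N)"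
    and "integrable N (\<lambda>\<omega>. Z i \<omega> * Z k \<omega>)"
proof -
  interpret prob_space N by fact
  have "indep_vars (\<lambda>_. borel) Z {i, k}"
    using assms(2-4) by (auto intro: indep_vars_subset)
  from indep_vars_lebesgue_integral[OF _ this] indep_vars_integrable[OF _ this] assms(5-)
  show "(\<integral>\<omega>. Z i \<omega> * Z k \<omega> \<partial>N) = (\<integral>\<omega>. Z i \<omega> \<partial>N) * (\<integral>\<omega>. Z k \<omega> \<partial>N)"
    "integrable N (\<lambda>\<omega>. Z i \<omega> * Z k \<omega>)" by auto
qed

context prob_seq
begin

text \<open>Chebyshev's inequality: with vanishing cross terms the second moment of the sum is at
  most n times \<open>\<bar>c\<bar>\<close>, so dividing by the root of n leaves it bounded. Asking
  for zero correlation rather than independence admits noise weighted by a design that is dependent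
  across units.\<close>

lemma bounded_in_prob_uncorrelated:
  fixes \<zeta> :: "nat \<Rightarrow> nat \<Rightarrow> 'a \<Rightarrow> real"
  assumes meas: "\<And>n i. i < n \<Longrightarrow> \<zeta> n i \<in> borel_measurable (M n)"
    and int: "\<And>n i k. i < n \<Longrightarrow> k < n \<Longrightarrow> integrable (M n) (\<lambda>\<omega>. \<zeta> n i \<omega> * \<zeta> n k \<omega>)"
    and uncor: "\<And>n i k. i < n \<Longrightarrow> k < n \<Longrightarrow> i \<noteq> k \<Longrightarrow> (\<integral>\<omega>. \<zeta> n i \<omega> * \<zeta> n k \<omega> \<partial>M n) = 0"
    and var: "\<And>n i. i < n \<Longrightarrow> (\<integral>\<omega>. (\<zeta> n i \<omega>)\<^sup>2 \<partial>M n) \<le> c"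
  shows "bounded_in_prob M (\<lambda>n \<omega>. (\<Sum>i<n. \<zeta> n i \<omega>) / sqrt (real n))"
  unfolding bounded_in_prob_def
proof (intro conjI allI impI)
  have meas_sum: "(\<lambda>\<omega>. (\<Sum>i<n. \<zeta> n i \<omega>) / sqrt (real n)) \<in> borel_measurable (M n)" for n
    using meas by (intro borel_measurable_divide borel_measurable_sum borel_measurable_const) auto
  then show "(\<lambda>\<omega>. (\<Sum>i<n. \<zeta> n i \<omega>) / sqrt (real n)) \<in> borel_measurable (M n)" for n .
  fix \<delta> :: real assume \<delta>: "\<delta> > 0"
  \<comment> \<open>The final estimate is \<open>\<bar>c\<bar> / K\<^sup>2\<close>, which this
    choice keeps below \<delta>; the added 1 makes \<open>K\<close> positive even for
    \<open>c = 0\<close>.\<close>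
  define K where "K = sqrt ((\<bar>c\<bar> + 1) / \<delta>)"
  have K: "K > 0" "K\<^sup>2 = (\<bar>c\<bar> + 1) / \<delta>" using \<delta> by (simp_all add: K_def)
  have "measure (M n) {\<omega> \<in> space (M n). \<bar>(\<Sum>i<n. \<zeta> n i \<omega>) / sqrt (real n)\<bar> > K} \<le> \<delta>" if n: "n > 0" for n
  proof -
    interpret prob_space "M n" by (rule prob_space_M)
    let ?S = "\<lambda>\<omega>. (\<Sum>i<n. \<zeta> n i \<omega>)"
    have sq: "(?S \<omega>)\<^sup>2 = (\<Sum>i<n. \<Sum>k<n. \<zeta> n i \<omega> * \<zeta> n k \<omega>)" for \<omega>
      by (simp add: power2_eq_square sum_product)
    have intS: "integrable (M n) (\<lambda>\<omega>. (?S \<omega>)\<^sup>2)"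
      unfolding sq by (intro Bochner_Integration.integrable_sum int) auto
    have "expectation (\<lambda>\<omega>. (?S \<omega>)\<^sup>2) = (\<Sum>i<n. \<Sum>k<n. expectation (\<lambda>\<omega>. \<zeta> n i \<omega> * \<zeta> n k \<omega>))"
    proof -
      have "expectation (\<lambda>\<omega>. (?S \<omega>)\<^sup>2) = (\<Sum>i<n. expectation (\<lambda>\<omega>. \<Sum>k<n. \<zeta> n i \<omega> * \<zeta> n k \<omega>))"
        unfolding sq
        by (intro Bochner_Integration.integral_sum Bochner_Integration.integrable_sum int) auto
      also have "\<dots> = (\<Sum>i<n. \<Sum>k<n. expectation (\<lambda>\<omega>. \<zeta> n i \<omega> * \<zeta> n k \<omega>))"
        by (intro sum.cong refl Bochner_Integration.integral_sum int) auto
      finally show ?thesis .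
    qed
    \<comment> \<open>Only the diagonal of the double sum survives.\<close>
    also have "\<dots> = (\<Sum>i<n. \<Sum>k<n. if k = i then expectation (\<lambda>\<omega>. (\<zeta> n i \<omega>)\<^sup>2) else 0)"
      using uncor by (intro sum.cong) (auto simp: power2_eq_square)
    also have "\<dots> = (\<Sum>i<n. expectation (\<lambda>\<omega>. (\<zeta> n i \<omega>)\<^sup>2))" by simp
    also have "\<dots> \<le> (\<Sum>i<n. \<bar>c\<bar>)" by (intro sum_mono order_trans[OF var abs_ge_self]) auto
    finally have E: "expectation (\<lambda>\<omega>. (?S \<omega>)\<^sup>2) \<le> real n * \<bar>c\<bar>" by simp
    have pos: "K\<^sup>2 * real n > 0" using K(1) n by simp
    have le: "(?S \<omega>)\<^sup>2 \<ge> K\<^sup>2 * real n" if "\<bar>?S \<omega> / sqrt (real n)\<bar> > K" for \<omega>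
    proof -
      have "K * sqrt (real n) \<le> \<bar>?S \<omega>\<bar>"
        using that n by (simp add: abs_divide pos_less_divide_eq)
      then have "(K * sqrt (real n))\<^sup>2 \<le> \<bar>?S \<omega>\<bar>\<^sup>2"
        using K by (intro power_mono) auto
      then show ?thesis by (simp add: power_mult_distrib)
    qed
    have "prob {\<omega> \<in> space (M n). \<bar>?S \<omega> / sqrt (real n)\<bar> > K} \<le>
        prob {\<omega> \<in> space (M n). (?S \<omega>)\<^sup>2 \<ge> K\<^sup>2 * real n}"
      using le borel_measurable_integrable[OF intS] by (intro finite_measure_mono) auto
    also have "\<dots> \<le> expectation (\<lambda>\<omega>. (?S \<omega>)\<^sup>2) / (K\<^sup>2 * real n)"
      by (rule integral_Markov_inequality_measure[OF intS, where A = "{}"]) (auto intro: pos)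
    also have "\<dots> \<le> (real n * \<bar>c\<bar>) / (K\<^sup>2 * real n)"
      using E pos by (intro divide_right_mono) auto
    also have "\<dots> = \<bar>c\<bar> / K\<^sup>2" using n by simp
    also have "\<dots> \<le> \<delta>" unfolding K(2) using \<delta> by (simp add: field_simps)
    finally show ?thesis .
  qed
  then show "\<exists>K>0. \<forall>\<^sub>F n in sequentially.
      measure (M n) {\<omega> \<in> space (M n). \<bar>(\<Sum>i<n. \<zeta> n i \<omega>) / sqrt (real n)\<bar> > K} \<le> \<delta>"
    using K(1) by (intro exI[of _ K]) (auto intro: eventually_mono[OF eventually_gt_at_top[of 0]])
qed

lemma bounded_in_prob_indep:
  fixes \<zeta> :: "nat \<Rightarrow> nat \<Rightarrow> 'a \<Rightarrow> real"
  assumes indep: "\<And>n. prob_space.indep_vars (M n) (\<lambda>_. borel) (\<zeta> n) {..<n}"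
    and sq: "\<And>n i. i < n \<Longrightarrow> integrable (M n) (\<lambda>\<omega>. (\<zeta> n i \<omega>)\<^sup>2)"
    and mean: "\<And>n i. i < n \<Longrightarrow> (\<integral>\<omega>. \<zeta> n i \<omega> \<partial>M n) = 0"
    and var: "\<And>n i. i < n \<Longrightarrow> (\<integral>\<omega>. (\<zeta> n i \<omega>)\<^sup>2 \<partial>M n) \<le> c"
  shows "bounded_in_prob M (\<lambda>n \<omega>. (\<Sum>i<n. \<zeta> n i \<omega>) / sqrt (real n))"
proof (rule bounded_in_prob_uncorrelated[OF _ _ _ var])
  fix n i :: nat assume i: "i < n"
  interpret prob_space "M n" by (rule prob_space_M)
  show meas: "\<zeta> n i \<in> borel_measurable (M n)" if "i < n" for i
    using indep[of n] that by (auto simp: indep_vars_def)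
  have int: "integrable (M n) (\<zeta> n i)" if "i < n" for i
    using square_integrable_imp_integrable[OF meas sq] that by simp
  fix k assume k: "k < n"
  show "integrable (M n) (\<lambda>\<omega>. \<zeta> n i \<omega> * \<zeta> n k \<omega>)"
    by (intro integrable_mult_of_square meas sq i k)
  assume "i \<noteq> k"
  then show "(\<integral>\<omega>. \<zeta> n i \<omega> * \<zeta> n k \<omega> \<partial>M n) = 0"
    using indep_vars_expectation_mult(1)[OF prob_space_M indep, of i n k] i k int mean by simp
qed

text \<open>
  Truncation at level \<open>K\<close>: Chebyshev's inequality for the truncated part, Markov's for the rest.
\<close>

lemma weak_law_of_large_numbers:
  fixes \<zeta> :: "nat \<Rightarrow> nat \<Rightarrow> 'a \<Rightarrow> real" and Z :: "'b \<Rightarrow> real"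
  assumes indep: "\<And>n. prob_space.indep_vars (M n) (\<lambda>_. borel) (\<zeta> n) {..<n}"
    and distr: "\<And>n i. i < n \<Longrightarrow> distr (M n) borel (\<zeta> n i) = distr N borel Z"
    and "prob_space N" and Z: "integrable N Z"
  shows "tendsto_in_prob M (\<lambda>n \<omega>. (\<Sum>i<n. \<zeta> n i \<omega>) / real n) (\<integral>\<omega>. Z \<omega> \<partial>N)"
proof (rule tendsto_in_probI)
  interpret N: prob_space N by fact
  have meas: "\<zeta> n i \<in> borel_measurable (M n)" if "i < n" for n i
    using indep[of n] that unfolding prob_space.indep_vars_def[OF prob_space_M] by auto
  have Zm[measurable]: "Z \<in> borel_measurable N" using Z by simp
  show "(\<lambda>\<omega>. (\<Sum>i<n. \<zeta> n i \<omega>) / real n) \<in> borel_measurable (M n)" for n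
    using meas by (intro borel_measurable_divide borel_measurable_sum borel_measurable_const) auto
  \<comment> \<open>Every moment is computed for the single variable \<open>Z\<close>, so all bounds
    are uniform in n and i.\<close>
  have transfer: "(\<integral>\<omega>. f (\<zeta> n i \<omega>) \<partial>M n) = (\<integral>\<omega>. f (Z \<omega>) \<partial>N)"
    "integrable (M n) (\<lambda>\<omega>. f (\<zeta> n i \<omega>)) \<longleftrightarrow> integrable N (\<lambda>\<omega>. f (Z \<omega>))"
    if "i < n" "f \<in> borel_measurable borel" for n i and f :: "real \<Rightarrow> real"
    using integral_distr[OF meas that(2)] integral_distr[OF Zm that(2)]
      integrable_distr_eq[OF meas that(2)] integrable_distr_eq[OF Zm that(2)] distr that(1) by simp_all
  define trunc :: "nat \<Rightarrow> real \<Rightarrow> real" where "trunc K y = (if \<bar>y\<bar> \<le> real K then y else 0)" for K y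
  have trunc_meas[measurable]: "trunc K \<in> borel_measurable borel" for K
    unfolding trunc_def by measurable
  have trunc_le: "\<bar>trunc K y\<bar> \<le> \<bar>y\<bar>" "\<bar>trunc K y\<bar> \<le> real K" for K y
    by (auto simp: trunc_def)
  \<comment> \<open>The discarded part is dominated by the absolute value of \<open>Z\<close>, so a
    first moment suffices for dominated convergence; levels are natural numbers in order to form a
    sequence.\<close>
  have lim: "(\<lambda>K. \<integral>\<omega>. \<bar>Z \<omega> - trunc K (Z \<omega>)\<bar> \<partial>N) \<longlonglongrightarrow> (\<integral>\<omega>. 0 \<partial>N)"
  proof (rule integral_dominated_convergence[where w = "\<lambda>\<omega>. \<bar>Z \<omega>\<bar>"])
    show "AE \<omega> in N. (\<lambda>K. \<bar>Z \<omega> - trunc K (Z \<omega>)\<bar>) \<longlonglongrightarrow> 0"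
    proof (intro AE_I2 tendsto_eventually)
      fix \<omega>
      obtain K0 where "\<bar>Z \<omega>\<bar> \<le> real K0" using real_arch_simple by blast
      then show "\<forall>\<^sub>F K in sequentially. \<bar>Z \<omega> - trunc K (Z \<omega>)\<bar> = 0"
        by (intro eventually_mono[OF eventually_ge_at_top[of K0]]) (auto simp: trunc_def)
    qed
  qed (use Z in \<open>auto simp: trunc_def\<close>)
  fix \<delta> \<eta> :: real assume \<delta>: "\<delta> > 0" and \<eta>: "\<eta> > 0"
  \<comment> \<open>The first entry bounds the shift of the mean caused by truncation; the second
    makes the later Markov bound \<open>3 * \<gamma> / \<delta>\<close> at most \<eta>/2.\<close>
  define \<gamma> where "\<gamma> = min (\<delta>/3) (\<eta> * \<delta> / 6)"
  have "\<gamma> > 0" using \<delta> \<eta> by (simp add: \<gamma>_def)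
  from order_tendstoD(2)[OF lim[simplified] this]
  obtain K where K: "(\<integral>\<omega>. \<bar>Z \<omega> - trunc K (Z \<omega>)\<bar> \<partial>N) < \<gamma>"
    by (auto simp: eventually_sequentially)
  define m where "m = (\<integral>\<omega>. Z \<omega> \<partial>N)"
  define mK where "mK = (\<integral>\<omega>. trunc K (Z \<omega>) \<partial>N)"
  have intK: "integrable N (\<lambda>\<omega>. trunc K (Z \<omega>))"
    by (rule N.integrable_const_bound[of _ "real K"]) (auto simp: trunc_le)
  have "m - mK = (\<integral>\<omega>. Z \<omega> - trunc K (Z \<omega>) \<partial>N)"
    unfolding m_def mK_def using Z intK by simp
  then have "\<bar>m - mK\<bar> \<le> (\<integral>\<omega>. \<bar>Z \<omega> - trunc K (Z \<omega>)\<bar> \<partial>N)"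
    using integral_abs_bound[of N "\<lambda>\<omega>. Z \<omega> - trunc K (Z \<omega>)"] by simp
  with K have mean_gap: "\<bar>m - mK\<bar> \<le> \<delta>/3" by (simp add: \<gamma>_def)
  have mK_le: "\<bar>mK\<bar> \<le> real K"
  proof -
    have "\<bar>mK\<bar> \<le> (\<integral>\<omega>. \<bar>trunc K (Z \<omega>)\<bar> \<partial>N)" unfolding mK_def by (rule integral_abs_bound)
    also have "\<dots> \<le> (\<integral>\<omega>. real K \<partial>N)" using intK by (intro integral_mono) (auto simp: trunc_le)
    finally show ?thesis by (simp add: N.prob_space)
  qed
  have sq_le: "(trunc K y - mK)\<^sup>2 \<le> 4 * (real K)\<^sup>2" for y
  proof -
    have "\<bar>trunc K y - mK\<bar> \<le> 2 * real K" using trunc_le(2)[of K y] mK_le by linarith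
    then have "\<bar>trunc K y - mK\<bar>\<^sup>2 \<le> (2 * real K)\<^sup>2" by (intro power_mono) auto
    then show ?thesis by (simp add: power_mult_distrib)
  qed
  have sq_int: "integrable N (\<lambda>\<omega>. (trunc K (Z \<omega>) - mK)\<^sup>2)"
    by (rule N.integrable_const_bound[of _ "4 * (real K)\<^sup>2"]) (auto simp: sq_le)
  \<comment> \<open>From here \<open>K\<close> is fixed: the centred truncated variables are at most
    2K in absolute value, so their second moments are bounded and the root-n bound applies.\<close>
  have "bounded_in_prob M (\<lambda>n \<omega>. (\<Sum>i<n. trunc K (\<zeta> n i \<omega>) - mK) / sqrt (real n))"
  proof (rule bounded_in_prob_indep)
    show "prob_space.indep_vars (M n) (\<lambda>_. borel) (\<lambda>i \<omega>. trunc K (\<zeta> n i \<omega>) - mK) {..<n}" for n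
      by (rule prob_space.indep_vars_compose2[OF prob_space_M indep]) measurable
    fix n i :: nat assume i: "i < n"
    show "integrable (M n) (\<lambda>\<omega>. (trunc K (\<zeta> n i \<omega>) - mK)\<^sup>2)"
      using transfer(2)[OF i, of "\<lambda>y. (trunc K y - mK)\<^sup>2"] sq_int by simp
    show "(\<integral>\<omega>. trunc K (\<zeta> n i \<omega>) - mK \<partial>M n) = 0"
      using transfer(1)[OF i, of "\<lambda>y. trunc K y - mK"] intK by (simp add: mK_def N.prob_space)
    have "(\<integral>\<omega>. (trunc K (\<zeta> n i \<omega>) - mK)\<^sup>2 \<partial>M n) = (\<integral>\<omega>. (trunc K (Z \<omega>) - mK)\<^sup>2 \<partial>N)"
      using transfer(1)[OF i, of "\<lambda>y. (trunc K y - mK)\<^sup>2"] by simp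
    also have "\<dots> \<le> (\<integral>\<omega>. 4 * (real K)\<^sup>2 \<partial>N)" using sq_int by (intro integral_mono) (auto simp: sq_le)
    finally show "(\<integral>\<omega>. (trunc K (\<zeta> n i \<omega>) - mK)\<^sup>2 \<partial>M n) \<le> 4 * (real K)\<^sup>2"
      by (simp add: N.prob_space)
  qed
  from tendsto_in_prob_0_of_bounded[OF this]
  have tr: "tendsto_in_prob M (\<lambda>n \<omega>. (\<Sum>i<n. trunc K (\<zeta> n i \<omega>) - mK) / real n) 0" by simp
  have "\<delta>/3 > 0" "\<eta>/2 > 0" using \<delta> \<eta> by auto
  from tendsto_in_prob_ev[OF tr this] eventually_gt_at_top[of 0]
  show "\<forall>\<^sub>F n in sequentially. measure (M n)
     {\<omega> \<in> space (M n). \<bar>(\<Sum>i<n. \<zeta> n i \<omega>) / real n - (\<integral>\<omega>. Z \<omega> \<partial>N)\<bar> > \<delta>} \<le> \<eta>"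
  proof eventually_elim
    case (elim n)
    let ?g = "\<lambda>y. \<bar>y - trunc K y\<bar>"
    let ?R = "\<lambda>\<omega>. (\<Sum>i<n. ?g (\<zeta> n i \<omega>))"
    have g_int: "integrable (M n) (\<lambda>\<omega>. ?g (\<zeta> n i \<omega>))" if "i < n" for i
      using transfer(2)[OF that, of ?g] Z intK by simp
    have R_int: "integrable (M n) ?R" using g_int by auto
    have "(\<integral>\<omega>. ?R \<omega> \<partial>M n) = (\<Sum>i<n. \<integral>\<omega>. ?g (\<zeta> n i \<omega>) \<partial>M n)"
      using g_int by (intro Bochner_Integration.integral_sum) auto
    also have "\<dots> = (\<Sum>i<n. \<integral>\<omega>. ?g (Z \<omega>) \<partial>N)"
      using transfer(1)[of _ n ?g] by (intro sum.cong) auto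
    also have "\<dots> \<le> real n * \<gamma>" using K by (simp add: mult_left_mono)
    finally have ER: "(\<integral>\<omega>. ?R \<omega> \<partial>M n) \<le> real n * \<gamma>" .
    have "measure (M n) {\<omega> \<in> space (M n). ?R \<omega> \<ge> \<delta>/3 * real n} \<le> (\<integral>\<omega>. ?R \<omega> \<partial>M n) / (\<delta>/3 * real n)"
      using \<delta> elim(2)
      by (intro integral_Markov_inequality_measure[OF R_int, where A = "{}"]) (auto intro!: sum_nonneg)
    also have "\<dots> \<le> (real n * \<gamma>) / (\<delta>/3 * real n)"
      using ER \<delta> by (intro divide_right_mono) auto
    also have "\<dots> = 3 * \<gamma> / \<delta>" using elim(2) \<delta> by (simp add: field_simps)
    also have "\<dots> \<le> \<eta>/2"
      using \<delta> by (simp add: \<gamma>_def pos_divide_le_eq min_le_iff_disj)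
    finally have tail: "measure (M n) {\<omega> \<in> space (M n). ?R \<omega> \<ge> \<delta>/3 * real n} \<le> \<eta>/2" .
    have meas1: "(\<lambda>\<omega>. (\<Sum>i<n. trunc K (\<zeta> n i \<omega>) - mK) / real n - 0) \<in> borel_measurable (M n)"
      using tendsto_in_prob_measurable[OF tr, of n] by simp
    have "measure (M n) {\<omega> \<in> space (M n). \<bar>(\<Sum>i<n. \<zeta> n i \<omega>) / real n - m\<bar> > \<delta>} \<le> \<eta>/2 + \<eta>/2"
    proof (rule measure_le_add[OF _ _ _ elim(1) tail])
      show "Measurable.pred (M n) (\<lambda>\<omega>. \<bar>(\<Sum>i<n. trunc K (\<zeta> n i \<omega>) - mK) / real n - 0\<bar> > \<delta>/3)"
        using meas1 by measurable
      show "Measurable.pred (M n) (\<lambda>\<omega>. ?R \<omega> \<ge> \<delta>/3 * real n)"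
        using borel_measurable_integrable[OF R_int] by measurable
      fix \<omega> assume big: "\<bar>(\<Sum>i<n. \<zeta> n i \<omega>) / real n - m\<bar> > \<delta>"
      show "\<bar>(\<Sum>i<n. trunc K (\<zeta> n i \<omega>) - mK) / real n - 0\<bar> > \<delta>/3 \<or> ?R \<omega> \<ge> \<delta>/3 * real n"
      proof (rule ccontr)
        assume "\<not> ?thesis"
        then have 1: "\<bar>(\<Sum>i<n. trunc K (\<zeta> n i \<omega>) - mK) / real n\<bar> \<le> \<delta>/3" and 2: "?R \<omega> < \<delta>/3 * real n"
          by auto
        have "\<bar>\<Sum>i<n. \<zeta> n i \<omega> - trunc K (\<zeta> n i \<omega>)\<bar> \<le> ?R \<omega>" by (rule sum_abs)
        with 2 have "\<bar>\<Sum>i<n. \<zeta> n i \<omega> - trunc K (\<zeta> n i \<omega>)\<bar> \<le> \<delta>/3 * real n" by linarith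
        then have 3: "\<bar>(\<Sum>i<n. \<zeta> n i \<omega> - trunc K (\<zeta> n i \<omega>)) / real n\<bar> \<le> \<delta>/3"
          using elim(2) by (simp add: abs_divide pos_divide_le_eq)
        \<comment> \<open>Three errors of at most \<delta>/3 each: the discarded tails, the
          fluctuation of the truncated average, and the shift of the mean.\<close>
        have "(\<Sum>i<n. \<zeta> n i \<omega>) / real n - m = (\<Sum>i<n. \<zeta> n i \<omega> - trunc K (\<zeta> n i \<omega>)) / real n
            + (\<Sum>i<n. trunc K (\<zeta> n i \<omega>) - mK) / real n + (mK - m)"
          using elim(2) by (simp add: sum_subtractf field_simps)
        with 1 3 mean_gap big show False by linarith
      qed
    qed
    then show ?case by (simp add: m_def)
  qed
qed

text \<open>
  Convergence in distribution gives tightness: the expectation of a continuous ramp that dominates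
  \<open>indicator {\<bar>z\<^sub>j\<bar> > K + 1}\<close> and vanishes on \<open>\<bar>z\<^sub>j\<bar> \<le> K\<close> converges to a limit of size at most \<open>E\<bar>\<xi>\<^sub>j\<bar> / K\<close>.
\<close>

lemma bounded_in_prob_of_tendsto_in_distr:
  assumes conv: "tendsto_in_distr d M Z L \<xi>" and meas: "\<And>n j. j < d \<Longrightarrow> Z n j \<in> borel_measurable (M n)"
    and "prob_space L" and \<xi>: "integrable L (\<xi> j)" and j: "j < d"
  shows "bounded_in_prob M (\<lambda>n. Z n j)"
  unfolding bounded_in_prob_def
proof (intro conjI allI impI)
  show "Z n j \<in> borel_measurable (M n)" for n by (rule meas[OF j])
  interpret L: prob_space L by fact
  fix \<delta> :: real assume \<delta>: "\<delta> > 0"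
  \<comment> \<open>The added 1 makes the limit of the ramp expectations strictly smaller than
    \<delta>, so that they fall below \<delta> for large n; it also keeps \<open>K\<close>
    positive.\<close>
  define K where "K = ((\<integral>\<omega>. \<bar>\<xi> j \<omega>\<bar> \<partial>L) + 1) / \<delta>"
  have E0: "(\<integral>\<omega>. \<bar>\<xi> j \<omega>\<bar> \<partial>L) \<ge> 0" by simp
  have K0: "K > 0" unfolding K_def using \<delta> E0 by (intro divide_pos_pos) linarith+
  define ramp where "ramp y = max 0 (min 1 (\<bar>y\<bar> - K))" for y :: real
  have ramp_meas[measurable]: "ramp \<in> borel_measurable borel" unfolding ramp_def by measurable
  have ramp_bd: "0 \<le> ramp y" "ramp y \<le> 1" "\<bar>ramp y\<bar> \<le> 1" for y by (auto simp: ramp_def)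
  let ?f = "\<lambda>z::nat \<Rightarrow> real. ramp (z j)"
  have "continuous_map euclideanreal euclideanreal ramp"
    unfolding ramp_def continuous_map_iff_continuous2 by (intro continuous_intros)
  from continuous_map_compose[OF continuous_map_product_projection[of j "{..<d}" "\<lambda>_. euclideanreal"] this]
  have "continuous_map (powertop_real {..<d}) euclideanreal ?f"
    using j by (simp add: o_def)
  moreover have "bounded (?f ` topspace (powertop_real {..<d}))"
  proof (rule boundedI[of _ 1])
    fix y assume "y \<in> ?f ` topspace (powertop_real {..<d})"
    then obtain z where "y = ramp (z j)" by blast
    then show "norm y \<le> 1" using ramp_bd(3) by simp
  qed
  ultimately have "(\<lambda>n. \<integral>\<omega>. ?f (\<lambda>j\<in>{..<d}. Z n j \<omega>) \<partial>M n) \<longlonglongrightarrow> (\<integral>\<omega>. ?f (\<lambda>j\<in>{..<d}. \<xi> j \<omega>) \<partial>L)"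
    by (intro conv[unfolded tendsto_in_distr_def, rule_format] conjI)
  then have lim: "(\<lambda>n. \<integral>\<omega>. ramp (Z n j \<omega>) \<partial>M n) \<longlonglongrightarrow> (\<integral>\<omega>. ramp (\<xi> j \<omega>) \<partial>L)"
    using j by simp
  have ramp_le: "ramp y \<le> \<bar>y\<bar> / K" for y
  proof (cases "\<bar>y\<bar> \<le> K")
    case True
    then show ?thesis using K0 by (simp add: ramp_def)
  next
    case False
    then have "1 \<le> \<bar>y\<bar> / K" using K0 by (simp add: pos_le_divide_eq)
    with ramp_bd(2)[of y] show ?thesis by linarith
  qed
  have [measurable]: "\<xi> j \<in> borel_measurable L" using \<xi> by simp
  have "(\<integral>\<omega>. ramp (\<xi> j \<omega>) \<partial>L) \<le> (\<integral>\<omega>. \<bar>\<xi> j \<omega>\<bar> / K \<partial>L)"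
  proof (rule integral_mono)
    show "integrable L (\<lambda>\<omega>. ramp (\<xi> j \<omega>))"
      by (rule L.integrable_const_bound[of _ 1]) (auto simp: ramp_bd)
  qed (use \<xi> in \<open>auto simp: ramp_le\<close>)
  also have "\<dots> = (\<integral>\<omega>. \<bar>\<xi> j \<omega>\<bar> \<partial>L) / K" by simp
  also have "\<dots> < \<delta>" using \<delta> E0 K0 unfolding pos_divide_less_eq[OF K0] by (simp add: K_def)
  finally have "\<forall>\<^sub>F n in sequentially. (\<integral>\<omega>. ramp (Z n j \<omega>) \<partial>M n) < \<delta>"
    by (rule order_tendstoD(2)[OF lim])
  then have "\<forall>\<^sub>F n in sequentially. measure (M n) {\<omega> \<in> space (M n). \<bar>Z n j \<omega>\<bar> > K + 1} \<le> \<delta>"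
  proof eventually_elim
    case (elim n)
    interpret prob_space "M n" by (rule prob_space_M)
    note [measurable] = meas[OF j, of n]
    have "measure (M n) {\<omega> \<in> space (M n). \<bar>Z n j \<omega>\<bar> > K + 1} =
        (\<integral>\<omega>. indicator {\<omega> \<in> space (M n). \<bar>Z n j \<omega>\<bar> > K + 1} \<omega> \<partial>M n)"
      by simp
    also have "\<dots> \<le> (\<integral>\<omega>. ramp (Z n j \<omega>) \<partial>M n)"
    proof (rule integral_mono)
      show "integrable (M n) (\<lambda>\<omega>. ramp (Z n j \<omega>))"
        by (rule integrable_const_bound[of _ 1]) (auto simp: ramp_bd)
      show "integrable (M n) (indicator {\<omega> \<in> space (M n). \<bar>Z n j \<omega>\<bar> > K + 1} :: 'a \<Rightarrow> real)"
        by (rule integrable_const_bound[of _ 1]) auto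
    qed (auto simp: ramp_def indicator_def)
    finally show ?case using elim by linarith
  qed
  then show "\<exists>K>0. \<forall>\<^sub>F n in sequentially. measure (M n) {\<omega> \<in> space (M n). \<bar>Z n j \<omega>\<bar> > K} \<le> \<delta>"
    using K0 by (intro exI[of _ "K + 1"]) auto
qed

end

section \<open>Least squares with a nearly diagonal Gram matrix\<close>

text \<open>With V the diagonal matrix of the \<open>v k\<close> and E = A - V, the system reads u -
  V^(-1) b = - V^(-1) E u. In the sum norm the right side is at most C D |u|, hence at most |u| / 2;
  absorbing it bounds |u| by 2 C |b|, and inserting this bound once more gives the second claim. The
  first claim with b = 0 shows that \<open>A\<close> has trivial kernel.\<close>

lemma perturbed_diagonal_solution:
  fixes A :: "nat \<Rightarrow> nat \<Rightarrow> real" and u b v :: "nat \<Rightarrow> real"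
  assumes v: "\<And>k. k < d \<Longrightarrow> v k > 0" and C: "\<And>k. k < d \<Longrightarrow> 1 / v k \<le> C" "C \<ge> 0"
    and D: "D = (\<Sum>k<d. \<Sum>l<d. \<bar>A k l - (if k = l then v k else 0)\<bar>)" and small: "C * D \<le> 1/2"
    and sol: "\<And>k. k < d \<Longrightarrow> (\<Sum>l<d. A k l * u l) = b k"
  shows "(\<Sum>k<d. \<bar>u k\<bar>) \<le> 2 * C * (\<Sum>k<d. \<bar>b k\<bar>)"
    and "(\<Sum>k<d. \<bar>u k - b k / v k\<bar>) \<le> 2 * C\<^sup>2 * D * (\<Sum>k<d. \<bar>b k\<bar>)"
proof -
  define E where "E k l = A k l - (if k = l then v k else 0)" for k l
  define U where "U = (\<Sum>k<d. \<bar>u k\<bar>)"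
  define B where "B = (\<Sum>k<d. \<bar>b k\<bar>)"
  have D0: "D \<ge> 0" unfolding D by (intro sum_nonneg) auto
  have U0: "U \<ge> 0" unfolding U_def by (intro sum_nonneg) auto
  have r: "\<bar>u k - b k / v k\<bar> \<le> C * ((\<Sum>l<d. \<bar>E k l\<bar>) * U)" if k: "k < d" for k
  proof -
    have "b k = (\<Sum>l<d. E k l * u l + (if k = l then v k * u l else 0))"
      unfolding sol[OF k, symmetric] by (intro sum.cong) (auto simp: E_def algebra_simps)
    also have "\<dots> = (\<Sum>l<d. E k l * u l) + v k * u k"
      using k by (simp add: sum.distrib)
    finally have "u k - b k / v k = - (1 / v k) * (\<Sum>l<d. E k l * u l)"
      using v[OF k] by (simp add: field_simps)
    then have "\<bar>u k - b k / v k\<bar> = (1 / v k) * \<bar>\<Sum>l<d. E k l * u l\<bar>"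
      using v[OF k] by (simp add: abs_mult)
    also have "\<dots> \<le> C * \<bar>\<Sum>l<d. E k l * u l\<bar>"
      by (intro mult_right_mono C(1) k) auto
    also have "\<bar>\<Sum>l<d. E k l * u l\<bar> \<le> (\<Sum>l<d. \<bar>E k l\<bar> * \<bar>u l\<bar>)"
      by (rule order_trans[OF sum_abs]) (simp add: abs_mult)
    \<comment> \<open>Bounding each coordinate by the whole norm is crude, but it makes
      \<open>D\<close>, the sum over all entries, the right measure of the perturbation.\<close>
    also have "\<dots> \<le> (\<Sum>l<d. \<bar>E k l\<bar> * U)"
      unfolding U_def by (intro sum_mono mult_left_mono member_le_sum) auto
    also have "\<dots> = (\<Sum>l<d. \<bar>E k l\<bar>) * U"
      by (simp add: sum_distrib_right)
    finally show ?thesis using C(2) by (simp add: mult_left_mono)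
  qed
  have "(\<Sum>k<d. \<bar>u k - b k / v k\<bar>) \<le> (\<Sum>k<d. C * ((\<Sum>l<d. \<bar>E k l\<bar>) * U))"
    by (intro sum_mono r) auto
  also have "\<dots> = C * D * U"
    by (simp add: D E_def sum_distrib_left sum_distrib_right mult.assoc)
  finally have R: "(\<Sum>k<d. \<bar>u k - b k / v k\<bar>) \<le> C * D * U" .
  have "\<bar>u k\<bar> \<le> \<bar>u k - b k / v k\<bar> + C * \<bar>b k\<bar>" if k: "k < d" for k
  proof -
    have "\<bar>b k / v k\<bar> = 1 / v k * \<bar>b k\<bar>" using v[OF k] by simp
    also have "\<dots> \<le> C * \<bar>b k\<bar>" by (intro mult_right_mono C k) auto
    finally show ?thesis by linarith
  qed
  then have "U \<le> (\<Sum>k<d. \<bar>u k - b k / v k\<bar> + C * \<bar>b k\<bar>)"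
    unfolding U_def by (intro sum_mono) auto
  also have "\<dots> = (\<Sum>k<d. \<bar>u k - b k / v k\<bar>) + C * B"
    by (simp add: sum.distrib B_def sum_distrib_left)
  also have "\<dots> \<le> C * D * U + C * B" using R by simp
  \<comment> \<open>The absorption: half of \<open>U\<close> moves to the left side, which produces
    the factor 2.\<close>
  also have "C * D * U \<le> 1/2 * U" using small U0 by (intro mult_right_mono) auto
  finally have U: "U \<le> 2 * C * B" by simp
  then show "(\<Sum>k<d. \<bar>u k\<bar>) \<le> 2 * C * (\<Sum>k<d. \<bar>b k\<bar>)" by (simp add: U_def B_def)
  have "C * D * U \<le> C * D * (2 * C * B)" using U C(2) D0 by (intro mult_left_mono) auto
  with R show "(\<Sum>k<d. \<bar>u k - b k / v k\<bar>) \<le> 2 * C\<^sup>2 * D * (\<Sum>k<d. \<bar>b k\<bar>)"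
    by (simp add: B_def power2_eq_square mult_ac)
qed

lemma mult_mat_vec_index:
  assumes "A \<in> carrier_mat n d" "z \<in> carrier_vec d" "k < n"
  shows "(A *\<^sub>v z) $ k = (\<Sum>l<d. A $$ (k, l) * z $ l)"
proof -
  have "(A *\<^sub>v z) $ k = Matrix.row A k \<bullet> z" using assms by simp
  then show ?thesis
    using assms by (auto simp: scalar_prod_def atLeast0LessThan intro!: sum.cong)
qed

text \<open>\<open>inv_mat\<close> unwraps an option; a nonzero determinant makes the matrix a unit
  and so rules out \<open>None\<close>.\<close>

lemma inv_mat_inverse:
  fixes A :: "real mat"
  assumes A: "A \<in> carrier_mat d d" and "Determinant.det A \<noteq> 0"
  shows "inv_mat A * A = 1\<^sub>m d" "A * inv_mat A = 1\<^sub>m d" "inv_mat A \<in> carrier_mat d d"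
proof -
  have "A \<in> Units (ring_mat TYPE(real) d ())"
    by (rule det_non_zero_imp_unit[OF assms])
  with mat_inverse(1)[OF A] obtain B where "mat_inverse A = Some B" by fastforce
  from mat_inverse(2)[OF A this] this
  show "inv_mat A * A = 1\<^sub>m d" "A * inv_mat A = 1\<^sub>m d" "inv_mat A \<in> carrier_mat d d"
    by (simp_all add: inv_mat_def)
qed

text \<open>Uniqueness of the inverse: the diagonal matrix of reciprocals is a right inverse, and
  associativity identifies it with \<open>inv_mat\<close>. The determinant is nonzero because its
  product with that of the right inverse is 1.\<close>

lemma inv_mat_diag:
  fixes v :: "nat \<Rightarrow> real"
  assumes v: "\<And>k. k < d \<Longrightarrow> v k \<noteq> 0"
  shows "inv_mat (mat_diag d v) = mat_diag d (\<lambda>k. 1 / v k)"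
proof -
  let ?V = "mat_diag d v" and ?W = "mat_diag d (\<lambda>k. 1 / v k)"
  have one: "?V * ?W = 1\<^sub>m d"
    unfolding mat_diag_diag using v by (intro eq_matI) (auto simp: mat_diag_def)
  have "Determinant.det ?V * Determinant.det ?W = 1"
    using det_mult[of ?V d ?W] one by simp
  then have "Determinant.det ?V \<noteq> 0" by auto
  note inv = inv_mat_inverse[OF mat_diag_dim this]
  have "inv_mat ?V = inv_mat ?V * (?V * ?W)"
    using inv(3) unfolding one by simp
  also have "\<dots> = (inv_mat ?V * ?V) * ?W"
    by (rule assoc_mult_mat[OF inv(3) mat_diag_dim mat_diag_dim, symmetric])
  also have "\<dots> = ?W" unfolding inv(1) by (rule left_mult_one_mat[OF mat_diag_dim])
  finally show ?thesis .
qed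

text \<open>
  The estimation error solves \<open>A u = b\<close> with \<open>A\<close> the normalised Gram matrix; where \<open>A\<close> is close to
  the diagonal matrix of the \<open>v k\<close> it is invertible and \<open>u k\<close> is close to \<open>b k / v k\<close>.
\<close>

lemma ols_remainder_bound:
  fixes G :: "real mat"
  assumes G: "G \<in> carrier_mat n d" and \<theta>: "\<theta> \<in> carrier_vec d" and w: "w \<in> carrier_vec n"
    and hat: "\<theta>_hat \<in> carrier_vec d" and ols: "is_ols_estimate G (G *\<^sub>v \<theta> + w) \<theta>_hat" and "n > 0"
    and v: "\<And>k. k < d \<Longrightarrow> v k > 0" and C: "\<And>k. k < d \<Longrightarrow> 1 / v k \<le> C" "C \<ge> 0"
    and D: "D = (\<Sum>k<d. \<Sum>l<d. \<bar>(G\<^sup>T * G) $$ (k, l) / real n - (if k = l then v k else 0)\<bar>)"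
    and small: "C * D \<le> 1/2"
    and b: "\<And>k. k < d \<Longrightarrow> b k = (G\<^sup>T *\<^sub>v w) $ k / sqrt (real n)"
  shows "(\<Sum>k<d. \<bar>sqrt (real n) * (\<theta>_hat $ k - \<theta> $ k) - b k / v k\<bar>) \<le> 2 * C\<^sup>2 * D * (\<Sum>k<d. \<bar>b k\<bar>)"
proof -
  let ?A = "G\<^sup>T * G"
  have A: "?A \<in> carrier_mat d d" using G by simp
  \<comment> \<open>A kernel vector solves the perturbed system with right side 0, so the first
    bound forces it to vanish.\<close>
  have "Determinant.det ?A \<noteq> 0"
  proof
    assume "Determinant.det ?A = 0"
    then obtain z where z: "z \<in> carrier_vec d" "z \<noteq> 0\<^sub>v d" "?A *\<^sub>v z = 0\<^sub>v d"
      using det_0_iff_vec_prod_zero[OF A] by blast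
    have kernel: "(\<Sum>l<d. ?A $$ (k, l) / real n * z $ l) = 0" if "k < d" for k
    proof -
      have "(\<Sum>l<d. ?A $$ (k, l) * z $ l) = 0"
        using mult_mat_vec_index[OF A z(1) that] that unfolding z(3) by simp
      then show ?thesis
        by (simp add: sum_divide_distrib[symmetric])
    qed
    have "(\<Sum>k<d. \<bar>z $ k\<bar>) \<le> 2 * C * (\<Sum>k<d. \<bar>0\<bar>)"
      by (rule perturbed_diagonal_solution(1)[OF v C D small, where b = "\<lambda>_. 0"]) (rule kernel | assumption)+
    then have "(\<Sum>k<d. \<bar>z $ k\<bar>) \<le> 0" by simp
    then have "(\<Sum>k<d. \<bar>z $ k\<bar>) = 0" by (intro antisym sum_nonneg) auto
    then have "\<forall>k<d. z $ k = 0" by (simp add: sum_nonneg_eq_0_iff)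
    then have "z = 0\<^sub>v d" using z(1) by (intro eq_vecI) auto
    with z(2) show False ..
  qed
  note inv = inv_mat_inverse[OF A this]
  have "invertible_mat ?A"
    using inv A unfolding invertible_mat_def inverts_mat_def by (intro conjI exI[of _ "inv_mat ?A"]) auto
  then have eq: "\<theta>_hat = inv_mat ?A *\<^sub>v (G\<^sup>T *\<^sub>v (G *\<^sub>v \<theta> + w))"
    using ols by (simp add: is_ols_estimate_def)
  have "?A *\<^sub>v \<theta>_hat = (?A * inv_mat ?A) *\<^sub>v (G\<^sup>T *\<^sub>v (G *\<^sub>v \<theta> + w))"
    unfolding eq using A inv(3) G w \<theta>
    by (intro assoc_mult_mat_vec[symmetric]) (auto intro!: mult_mat_vec_carrier[of _ d n])
  also have "\<dots> = G\<^sup>T *\<^sub>v (G *\<^sub>v \<theta> + w)"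
    unfolding inv(2) using G w \<theta> by (intro one_mult_mat_vec) (auto intro!: mult_mat_vec_carrier[of _ d n])
  also have "\<dots> = G\<^sup>T *\<^sub>v (G *\<^sub>v \<theta>) + G\<^sup>T *\<^sub>v w"
    using G w \<theta> by (intro mult_add_distrib_mat_vec[of _ d n]) auto
  also have "G\<^sup>T *\<^sub>v (G *\<^sub>v \<theta>) = ?A *\<^sub>v \<theta>"
    using G \<theta> by (intro assoc_mult_mat_vec[symmetric]) auto
  finally have normal: "?A *\<^sub>v \<theta>_hat = ?A *\<^sub>v \<theta> + G\<^sup>T *\<^sub>v w" .
  \<comment> \<open>The normal equations for the error, divided by the root of n: the Gram matrix
    absorbs a factor 1/n and the error is multiplied by the root of n.\<close>
  have system: "(\<Sum>l<d. ?A $$ (k, l) / real n * (sqrt (real n) * (\<theta>_hat $ l - \<theta> $ l))) = b k" if k: "k < d" for k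
  proof -
    have "(\<Sum>l<d. ?A $$ (k, l) * \<theta>_hat $ l) = (?A *\<^sub>v \<theta> + G\<^sup>T *\<^sub>v w) $ k"
      using mult_mat_vec_index[OF A hat k] unfolding normal by simp
    also have "\<dots> = (\<Sum>l<d. ?A $$ (k, l) * \<theta> $ l) + (G\<^sup>T *\<^sub>v w) $ k"
      using mult_mat_vec_index[OF A \<theta> k] G k by simp
    finally have *: "(\<Sum>l<d. ?A $$ (k, l) * (\<theta>_hat $ l - \<theta> $ l)) = (G\<^sup>T *\<^sub>v w) $ k"
      by (simp add: right_diff_distrib sum_subtractf)
    have "sqrt (real n) / real n = 1 / sqrt (real n)"
      using \<open>n > 0\<close> by (simp add: field_simps)
    then have "a / real n * (sqrt (real n) * c) = 1 / sqrt (real n) * (a * c)" for a c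
      by (metis (no_types, opaque_lifting) mult.assoc mult.commute times_divide_eq_left)
    then have "(\<Sum>l<d. ?A $$ (k, l) / real n * (sqrt (real n) * (\<theta>_hat $ l - \<theta> $ l)))
        = (\<Sum>l<d. (1 / sqrt (real n)) * (?A $$ (k, l) * (\<theta>_hat $ l - \<theta> $ l)))"
      by (simp only:)
    then show ?thesis
      unfolding b[OF k] * sum_distrib_left[symmetric] by simp
  qed
  show ?thesis
    by (rule perturbed_diagonal_solution(2)[OF v C D small]) (rule system | assumption)+
qed

section \<open>The Gram matrix and the score\<close>

text \<open>Brings the independence of design and noise, whose range types differ, into the form in
  which expectations of products factor. Preimages under a composite are among the preimages under
  the inner map, so independence is inherited.\<close>

lemma indep_var_het_compose:
  fixes f :: "'b \<Rightarrow> real" and g :: "'c \<Rightarrow> real"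
  assumes "prob_space M" and indep: "indep_var_het M S U R V"
    and f: "f \<in> borel_measurable S" and g: "g \<in> borel_measurable R"
  shows "prob_space.indep_var M borel (\<lambda>\<omega>. f (U \<omega>)) borel (\<lambda>\<omega>. g (V \<omega>))"
proof -
  interpret prob_space M by fact
  have U: "U \<in> M \<rightarrow>\<^sub>M S" and V: "V \<in> M \<rightarrow>\<^sub>M R"
    and sets: "indep_set {U -` A \<inter> space M |A. A \<in> sets S} {V -` B \<inter> space M |B. B \<in> sets R}"
    using indep by (auto simp: indep_var_het_def)
  have vimage: "{(\<lambda>\<omega>. h (W \<omega>)) -` A \<inter> space M |A. A \<in> sets borel} \<subseteq> {W -` A \<inter> space M |A. A \<in> sets P}"
    if h: "h \<in> borel_measurable P" and W: "W \<in> M \<rightarrow>\<^sub>M P" for h :: "'z \<Rightarrow> real" and W and P :: "'z measure"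
  proof safe
    fix A :: "real set" assume "A \<in> sets borel"
    then have "h -` A \<inter> space P \<in> sets P" using h by (rule measurable_sets[rotated])
    moreover have "(\<lambda>\<omega>. h (W \<omega>)) -` A \<inter> space M = W -` (h -` A \<inter> space P) \<inter> space M"
      using measurable_space[OF W] by auto
    ultimately show "\<exists>B. (\<lambda>\<omega>. h (W \<omega>)) -` A \<inter> space M = W -` B \<inter> space M \<and> B \<in> sets P"
      by blast
  qed
  \<comment> \<open>Stability under intersection lets independence pass to the generated
    sigma-algebras, in terms of which \<open>indep_var_eq\<close> is phrased.\<close>
  have stable: "Int_stable {h -` A \<inter> space M |A. A \<in> sets borel}" for h :: "'a \<Rightarrow> real"
  proof (rule Int_stableI, safe)
    fix A B :: "real set" assume "A \<in> sets borel" "B \<in> sets borel"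
    then show "\<exists>C. h -` A \<inter> space M \<inter> (h -` B \<inter> space M) = h -` C \<inter> space M \<and> C \<in> sets borel"
      by (intro exI[of _ "A \<inter> B"]) auto
  qed
  have "indep_set {(\<lambda>\<omega>. f (U \<omega>)) -` A \<inter> space M |A. A \<in> sets borel}
      {(\<lambda>\<omega>. g (V \<omega>)) -` A \<inter> space M |A. A \<in> sets borel}"
    unfolding indep_set_def
  proof (rule indep_sets_mono_sets[OF sets[unfolded indep_set_def]])
    fix i :: bool
    show "(case i of True \<Rightarrow> {(\<lambda>\<omega>. f (U \<omega>)) -` A \<inter> space M |A. A \<in> sets borel}
        | False \<Rightarrow> {(\<lambda>\<omega>. g (V \<omega>)) -` A \<inter> space M |A. A \<in> sets borel})
      \<subseteq> (case i of True \<Rightarrow> {U -` A \<inter> space M |A. A \<in> sets S} | False \<Rightarrow> {V -` B \<inter> space M |B. B \<in> sets R})"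
      using vimage[OF f U] vimage[OF g V] by (cases i) simp_all
  qed
  from indep_set_sigma_sets[OF this stable stable]
  show ?thesis
    unfolding indep_var_eq using measurable_compose[OF U f] measurable_compose[OF V g] by blast
qed

text \<open>The entries of \<open>design_mat\<close> as a plain function, so that the probabilistic
  estimates involve no matrices. Covariates start at column 2, after the two treatment
  columns.\<close>

definition regressor :: "(nat \<Rightarrow> real) \<Rightarrow> (nat \<Rightarrow> nat \<Rightarrow> real) \<Rightarrow> nat \<Rightarrow> nat \<Rightarrow> real" where
  "regressor t x i k = (if k = 0 then t i else if k = 1 then 1 - t i else x i (k - 2))"

section \<open>Root-n bounds for sums of covariates and of weighted noise\<close>

context covariate_adaptive_setting
begin

sublocale prob_seq M
  by (rule prob_seq.intro) (rule prob_M)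

abbreviation covariate_space :: "(nat \<Rightarrow> real) measure" where
  "covariate_space \<equiv> \<Pi>\<^sub>M j\<in>{..<p + q}. borel"

abbreviation covariate_vec :: "nat \<Rightarrow> nat \<Rightarrow> 'a \<Rightarrow> nat \<Rightarrow> real" where
  "covariate_vec n i \<omega> \<equiv> \<lambda>j\<in>{..<p + q}. x n i j \<omega>"

abbreviation common_vec :: "'b \<Rightarrow> nat \<Rightarrow> real" where
  "common_vec w \<equiv> \<lambda>j\<in>{..<p + q}. X j w"

lemma covariate_vec_measurable:
  "i < n \<Longrightarrow> covariate_vec n i \<in> M n \<rightarrow>\<^sub>M covariate_space"
  using x_indep[of n] unfolding prob_space.indep_vars_def[OF prob_M] by auto

lemma X_measurable: "j < p + q \<Longrightarrow> X j \<in> borel_measurable N"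
  using X_indep unfolding prob_space.indep_vars_def[OF prob_N] by auto

lemma common_vec_measurable: "common_vec \<in> N \<rightarrow>\<^sub>M covariate_space"
  by (intro measurable_restrict X_measurable) auto

lemma component_measurable:
  "j < p + q \<Longrightarrow> (\<lambda>z. z j) \<in> borel_measurable covariate_space"
  by (rule measurable_component_singleton) auto

lemma x_measurable: "i < n \<Longrightarrow> j < p + q \<Longrightarrow> x n i j \<in> borel_measurable (M n)"
  using measurable_compose[OF covariate_vec_measurable component_measurable, of i n j] by simp

lemma \<epsilon>_measurable: "i < n \<Longrightarrow> \<epsilon> n i \<in> borel_measurable (M n)"
  using \<epsilon>_indep[of n] unfolding prob_space.indep_vars_def[OF prob_M] by auto

lemma covariate_transfer:
  fixes f :: "(nat \<Rightarrow> real) \<Rightarrow> real"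
  assumes "i < n" "f \<in> borel_measurable covariate_space"
  shows "(\<integral>\<omega>. f (covariate_vec n i \<omega>) \<partial>M n) = (\<integral>w. f (common_vec w) \<partial>N)"
    and "integrable (M n) (\<lambda>\<omega>. f (covariate_vec n i \<omega>)) \<longleftrightarrow> integrable N (\<lambda>w. f (common_vec w))"
  unfolding integral_distr[OF covariate_vec_measurable[OF assms(1)] assms(2), symmetric]
    integral_distr[OF common_vec_measurable assms(2), symmetric]
    integrable_distr_eq[OF covariate_vec_measurable[OF assms(1)] assms(2), symmetric]
    integrable_distr_eq[OF common_vec_measurable assms(2), symmetric]
    x_distr[OF assms(1)]
  by (rule refl)+

text \<open>A general \<open>f\<close> serves single covariates and products of two of them
  alike.\<close>

lemma covariate_sum_bounded:
  fixes f :: "(nat \<Rightarrow> real) \<Rightarrow> real"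
  assumes f: "f \<in> borel_measurable covariate_space"
    and sq: "integrable N (\<lambda>w. (f (common_vec w))\<^sup>2)" and mean: "(\<integral>w. f (common_vec w) \<partial>N) = 0"
  shows "bounded_in_prob M (\<lambda>n \<omega>. (\<Sum>i<n. f (covariate_vec n i \<omega>)) / sqrt (real n))"
proof (rule bounded_in_prob_indep)
  show "prob_space.indep_vars (M n) (\<lambda>_. borel) (\<lambda>i \<omega>. f (covariate_vec n i \<omega>)) {..<n}" for n
    by (rule prob_space.indep_vars_compose2[OF prob_M x_indep f])
  have f2: "(\<lambda>z. (f z)\<^sup>2) \<in> borel_measurable covariate_space" using f by measurable
  fix n i :: nat assume i: "i < n"
  show "integrable (M n) (\<lambda>\<omega>. (f (covariate_vec n i \<omega>))\<^sup>2)"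
    using covariate_transfer(2)[OF i f2] sq by blast
  show "(\<integral>\<omega>. f (covariate_vec n i \<omega>) \<partial>M n) = 0"
    unfolding covariate_transfer(1)[OF i f] by (rule mean)
  show "(\<integral>\<omega>. (f (covariate_vec n i \<omega>))\<^sup>2 \<partial>M n) \<le> (\<integral>w. (f (common_vec w))\<^sup>2 \<partial>N)"
    unfolding covariate_transfer(1)[OF i f2] by (rule order_refl)
qed

lemma x_sum_bounded:
  assumes j: "j < p + q"
  shows "bounded_in_prob M (\<lambda>n \<omega>. (\<Sum>i<n. x n i j \<omega>) / sqrt (real n))"
  using covariate_sum_bounded[OF component_measurable[OF j]] j X_square_integrable X_mean by simp

text \<open>Independence of the two covariates acts twice: it gives the product mean zero and,
  applied to the squares, a finite second moment without any fourth moment.\<close>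

lemma x_product_sum_bounded:
  assumes j: "j < p + q" and k: "k < p + q" and "j \<noteq> k"
  shows "bounded_in_prob M (\<lambda>n \<omega>. (\<Sum>i<n. x n i j \<omega> * x n i k \<omega>) / sqrt (real n))"
proof -
  interpret N: prob_space N by (rule prob_N)
  have int: "integrable N (X j)" if "j < p + q" for j
    by (rule N.square_integrable_imp_integrable[OF X_measurable X_square_integrable]) (rule that)+
  have sq_indep: "N.indep_vars (\<lambda>_. borel) (\<lambda>j w. (X j w)\<^sup>2) {..<p + q}"
    by (rule N.indep_vars_compose2[OF X_indep]) measurable
  have "(\<lambda>z. z j * z k) \<in> borel_measurable covariate_space"
    by (intro borel_measurable_times component_measurable j k)
  moreover have "integrable N (\<lambda>w. (X j w)\<^sup>2 * (X k w)\<^sup>2)"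
    using indep_vars_expectation_mult(2)[OF prob_N sq_indep] assms X_square_integrable by simp
  moreover have "(\<integral>w. X j w * X k w \<partial>N) = 0"
    using indep_vars_expectation_mult(1)[OF prob_N X_indep, of j k] assms int X_mean by simp
  ultimately show ?thesis
    using covariate_sum_bounded[of "\<lambda>z. z j * z k"] j k by (simp add: power_mult_distrib)
qed

lemma variance_X: "j < p + q \<Longrightarrow> prob_space.variance N (X j) = (\<integral>w. (X j w)\<^sup>2 \<partial>N)"
  by (simp add: X_mean)

lemma x_square_sum_tendsto:
  assumes j: "j < p + q"
  shows "tendsto_in_prob M (\<lambda>n \<omega>. (\<Sum>i<n. x n i j \<omega> * x n i j \<omega>) / real n) (prob_space.variance N (X j))"
proof -
  let ?f = "\<lambda>z::nat \<Rightarrow> real. (z j)\<^sup>2"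
  have f: "?f \<in> borel_measurable covariate_space"
    by (intro borel_measurable_power component_measurable j)
  have "tendsto_in_prob M (\<lambda>n \<omega>. (\<Sum>i<n. ?f (covariate_vec n i \<omega>)) / real n) (\<integral>w. ?f (common_vec w) \<partial>N)"
  proof (rule weak_law_of_large_numbers[OF _ _ prob_N])
    show "prob_space.indep_vars (M n) (\<lambda>_. borel) (\<lambda>i \<omega>. ?f (covariate_vec n i \<omega>)) {..<n}" for n
      by (rule prob_space.indep_vars_compose2[OF prob_M x_indep f])
    show "integrable N (\<lambda>w. ?f (common_vec w))" using X_square_integrable j by simp
    fix n i :: nat assume i: "i < n"
    have "distr (M n) borel (\<lambda>\<omega>. ?f (covariate_vec n i \<omega>)) =
        distr (distr (M n) covariate_space (covariate_vec n i)) borel ?f"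
      by (subst distr_distr[OF f covariate_vec_measurable[OF i]]) (simp add: o_def)
    also have "\<dots> = distr N borel (\<lambda>w. ?f (common_vec w))"
      unfolding x_distr[OF i] by (subst distr_distr[OF f common_vec_measurable]) (simp add: o_def)
    finally show "distr (M n) borel (\<lambda>\<omega>. ?f (covariate_vec n i \<omega>)) = distr N borel (\<lambda>w. ?f (common_vec w))" .
  qed
  then show ?thesis unfolding variance_X[OF j] using j by (simp add: power2_eq_square)
qed

abbreviation design :: "nat \<Rightarrow> 'a \<Rightarrow> (nat \<Rightarrow> real) \<times> (nat \<Rightarrow> nat \<Rightarrow> real)" where
  "design n \<omega> \<equiv> (\<lambda>i\<in>{..<n}. T n i \<omega>, \<lambda>i\<in>{..<n}. covariate_vec n i \<omega>)"

abbreviation design_space :: "nat \<Rightarrow> ((nat \<Rightarrow> real) \<times> (nat \<Rightarrow> nat \<Rightarrow> real)) measure" where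
  "design_space n \<equiv> (\<Pi>\<^sub>M i\<in>{..<n}. borel) \<Otimes>\<^sub>M (\<Pi>\<^sub>M i\<in>{..<n}. covariate_space)"

text \<open>The weights may depend on the whole design, so the summands need not be independent. But
  a product of two summands regroups into a function of the design times a function of the noise;
  its expectation factors, and the noise factor vanishes for distinct units.\<close>

lemma design_noise_sum_bounded:
  fixes h :: "nat \<Rightarrow> nat \<Rightarrow> (nat \<Rightarrow> real) \<times> (nat \<Rightarrow> nat \<Rightarrow> real) \<Rightarrow> real"
  assumes h: "\<And>n i. i < n \<Longrightarrow> h n i \<in> borel_measurable (design_space n)"
    and h_sq: "\<And>n i. i < n \<Longrightarrow> integrable (M n) (\<lambda>\<omega>. (h n i (design n \<omega>))\<^sup>2)"
    and h_le: "\<And>n i. i < n \<Longrightarrow> (\<integral>\<omega>. (h n i (design n \<omega>))\<^sup>2 \<partial>M n) \<le> c"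
  shows "bounded_in_prob M (\<lambda>n \<omega>. (\<Sum>i<n. h n i (design n \<omega>) * \<epsilon> n i \<omega>) / sqrt (real n))"
proof (rule bounded_in_prob_uncorrelated)
  have design: "design n \<in> M n \<rightarrow>\<^sub>M design_space n" for n
    using design_indep_\<epsilon>[of n] by (simp add: indep_var_het_def)
  have h_meas: "(\<lambda>\<omega>. h n i (design n \<omega>)) \<in> borel_measurable (M n)" if "i < n" for n i
    by (rule measurable_compose[OF design h[OF that]])
  show "(\<lambda>\<omega>. h n i (design n \<omega>) * \<epsilon> n i \<omega>) \<in> borel_measurable (M n)" if "i < n" for n i
    by (intro borel_measurable_times h_meas \<epsilon>_measurable that)
  have product: "integrable (M n) (\<lambda>\<omega>. (h n i (design n \<omega>) * \<epsilon> n i \<omega>) * (h n k (design n \<omega>) * \<epsilon> n k \<omega>))"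
    "(\<integral>\<omega>. (h n i (design n \<omega>) * \<epsilon> n i \<omega>) * (h n k (design n \<omega>) * \<epsilon> n k \<omega>) \<partial>M n) =
      (\<integral>\<omega>. h n i (design n \<omega>) * h n k (design n \<omega>) \<partial>M n) * (\<integral>\<omega>. \<epsilon> n i \<omega> * \<epsilon> n k \<omega> \<partial>M n)"
    if i: "i < n" and k: "k < n" for n i k
  proof -
    interpret prob_space "M n" by (rule prob_M)
    have f: "(\<lambda>u. h n i u * h n k u) \<in> borel_measurable (design_space n)"
      by (intro borel_measurable_times h i k)
    have g: "(\<lambda>e. e i * e k) \<in> borel_measurable (\<Pi>\<^sub>M i\<in>{..<n}. borel :: real measure)"
      using i k by (intro borel_measurable_times measurable_component_singleton) auto
    have indep: "indep_var borel (\<lambda>\<omega>. h n i (design n \<omega>) * h n k (design n \<omega>)) borel (\<lambda>\<omega>. \<epsilon> n i \<omega> * \<epsilon> n k \<omega>)"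
      using indep_var_het_compose[OF prob_M design_indep_\<epsilon> f g] i k by simp
    have hh: "integrable (M n) (\<lambda>\<omega>. h n i (design n \<omega>) * h n k (design n \<omega>))"
      by (intro integrable_mult_of_square h_meas h_sq i k)
    have ee: "integrable (M n) (\<lambda>\<omega>. \<epsilon> n i \<omega> * \<epsilon> n k \<omega>)"
      by (intro integrable_mult_of_square \<epsilon>_measurable \<epsilon>_square_integrable i k)
    have eq: "(h n i (design n \<omega>) * \<epsilon> n i \<omega>) * (h n k (design n \<omega>) * \<epsilon> n k \<omega>) =
        (h n i (design n \<omega>) * h n k (design n \<omega>)) * (\<epsilon> n i \<omega> * \<epsilon> n k \<omega>)" for \<omega>
      by (simp only: mult_ac)
    show "integrable (M n) (\<lambda>\<omega>. (h n i (design n \<omega>) * \<epsilon> n i \<omega>) * (h n k (design n \<omega>) * \<epsilon> n k \<omega>))"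
      unfolding eq by (rule indep_var_integrable[OF indep hh ee])
    show "(\<integral>\<omega>. (h n i (design n \<omega>) * \<epsilon> n i \<omega>) * (h n k (design n \<omega>) * \<epsilon> n k \<omega>) \<partial>M n) =
      (\<integral>\<omega>. h n i (design n \<omega>) * h n k (design n \<omega>) \<partial>M n) * (\<integral>\<omega>. \<epsilon> n i \<omega> * \<epsilon> n k \<omega> \<partial>M n)"
      unfolding eq by (rule indep_var_lebesgue_integral[OF indep hh ee])
  qed
  show "integrable (M n) (\<lambda>\<omega>. (h n i (design n \<omega>) * \<epsilon> n i \<omega>) * (h n k (design n \<omega>) * \<epsilon> n k \<omega>))"
    if "i < n" "k < n" for n i k by (rule product(1)[OF that])
  show "(\<integral>\<omega>. (h n i (design n \<omega>) * \<epsilon> n i \<omega>) * (h n k (design n \<omega>) * \<epsilon> n k \<omega>) \<partial>M n) = 0"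
    if i: "i < n" and k: "k < n" and "i \<noteq> k" for n i k
  proof -
    interpret prob_space "M n" by (rule prob_M)
    have int: "integrable (M n) (\<epsilon> n i)" if "i < n" for i
      by (rule square_integrable_imp_integrable[OF \<epsilon>_measurable \<epsilon>_square_integrable]) (rule that)+
    have "(\<integral>\<omega>. \<epsilon> n i \<omega> * \<epsilon> n k \<omega> \<partial>M n) = 0"
      using indep_vars_expectation_mult(1)[OF prob_M \<epsilon>_indep, of i n k] that int \<epsilon>_mean by simp
    then show ?thesis unfolding product(2)[OF i k] by simp
  qed
  show "(\<integral>\<omega>. (h n i (design n \<omega>) * \<epsilon> n i \<omega>)\<^sup>2 \<partial>M n) \<le> c * \<sigma>\<^sup>2" if i: "i < n" for n i
  proof -
    have "(\<integral>\<omega>. (\<epsilon> n i \<omega>)\<^sup>2 \<partial>M n) = \<sigma>\<^sup>2"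
      using \<epsilon>_variance[OF i] \<epsilon>_mean[OF i] by simp
    then show ?thesis
      using product(2)[OF i i] h_le[OF i] by (simp add: power2_eq_square mult_right_mono)
  qed
qed

abbreviation reg :: "nat \<Rightarrow> 'a \<Rightarrow> nat \<Rightarrow> nat \<Rightarrow> real" where
  "reg n \<omega> \<equiv> regressor (\<lambda>i. T n i \<omega>) (\<lambda>i j. x n i j \<omega>)"

lemma reg_measurable:
  assumes "i < n" "k < p + 2"
  shows "(\<lambda>\<omega>. reg n \<omega> i k) \<in> borel_measurable (M n)"
proof -
  consider "k = 0" | "k = 1" | "k \<noteq> 0" "k \<noteq> 1" "k - 2 < p + q" using assms by linarith
  then show ?thesis
    unfolding regressor_def using T_measurable[OF assms(1)] x_measurable[OF assms(1)] by cases simp_all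
qed

lemma reg_noise_sum_bounded:
  assumes k: "k < p + 2"
  shows "bounded_in_prob M (\<lambda>n \<omega>. (\<Sum>i<n. reg n \<omega> i k * \<epsilon> n i \<omega>) / sqrt (real n))"
proof -
  \<comment> \<open>As a function of the restricted design this agrees with \<open>reg\<close> for i
    < n, the only units that the sums see.\<close>
  define h where "h n i u = regressor (fst u) (snd u) i k"
    for n i :: nat and u :: "(nat \<Rightarrow> real) \<times> (nat \<Rightarrow> nat \<Rightarrow> real)"
  have h_eq: "h n i (design n \<omega>) = reg n \<omega> i k" if "i < n" for n i \<omega>
    using that k by (auto simp: h_def regressor_def)
  have "bounded_in_prob M (\<lambda>n \<omega>. (\<Sum>i<n. h n i (design n \<omega>) * \<epsilon> n i \<omega>) / sqrt (real n))"
  proof (rule design_noise_sum_bounded)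
    fix n i :: nat assume i: "i < n"
    interpret prob_space "M n" by (rule prob_M)
    have fst: "(\<lambda>u. fst u i) \<in> borel_measurable (design_space n)"
      using i by (intro measurable_compose[OF measurable_fst measurable_component_singleton]) auto
    have snd: "(\<lambda>u. snd u i j) \<in> borel_measurable (design_space n)" if "j < p + q" for j
      using i by (intro measurable_compose[OF _ component_measurable[OF that]]
          measurable_compose[OF measurable_snd measurable_component_singleton]) auto
    show "h n i \<in> borel_measurable (design_space n)"
    proof -
      consider "k = 0" | "k = 1" | "k \<noteq> 0" "k \<noteq> 1" "k - 2 < p + q" using k by linarith
      then show ?thesis
        unfolding h_def regressor_def using fst snd by cases simp_all
    qed
    have binary: "\<bar>reg n \<omega> i k\<bar> \<le> 1" if "k < 2" "\<omega> \<in> space (M n)" for \<omega>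
      using T_binary[OF i that(2)] that(1) by (auto simp: regressor_def)
    \<comment> \<open>Treatment columns are bounded by 1, covariate columns have the second moment
      of \<open>X (k - 2)\<close>. For k < 2 the index k - 2 is 0 by truncated subtraction, and the
      maximum is at least 1 whatever that integral is.\<close>
    have "integrable (M n) (\<lambda>\<omega>. (reg n \<omega> i k)\<^sup>2) \<and>
      (\<integral>\<omega>. (reg n \<omega> i k)\<^sup>2 \<partial>M n) \<le> max 1 (\<integral>w. (X (k - 2) w)\<^sup>2 \<partial>N)"
    proof (cases "k < 2")
      case True
      then have le: "(reg n \<omega> i k)\<^sup>2 \<le> 1" if "\<omega> \<in> space (M n)" for \<omega>
        using binary[OF True that] by (simp add: abs_square_le_1)
      have int: "integrable (M n) (\<lambda>\<omega>. (reg n \<omega> i k)\<^sup>2)"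
        using reg_measurable[OF i k] le by (intro integrable_const_bound[of _ 1] AE_I2) auto
      have "(\<integral>\<omega>. (reg n \<omega> i k)\<^sup>2 \<partial>M n) \<le> (\<integral>\<omega>. 1 \<partial>M n)"
        using int le by (intro integral_mono) auto
      with int show ?thesis by (simp add: prob_space)
    next
      case False
      then have j: "k - 2 < p + q" using k by auto
      have "(\<lambda>z. (z (k - 2))\<^sup>2) \<in> borel_measurable covariate_space"
        by (intro borel_measurable_power component_measurable j)
      from covariate_transfer[OF i this] X_square_integrable[OF j] j False show ?thesis
        by (auto simp: regressor_def)
    qed
    then show "integrable (M n) (\<lambda>\<omega>. (h n i (design n \<omega>))\<^sup>2)"
      "(\<integral>\<omega>. (h n i (design n \<omega>))\<^sup>2 \<partial>M n) \<le> max 1 (\<integral>w. (X (k - 2) w)\<^sup>2 \<partial>N)"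
      unfolding h_eq[OF i] by auto
  qed
  then show ?thesis by (simp add: h_eq)
qed

end

section \<open>Algebra of the design matrix and the response\<close>

lemma design_mat_carrier: "design_mat p n t x \<in> carrier_mat n (p + 2)"
  unfolding design_mat_def X_in_def by (rule carrier_matI) simp_all

lemma design_mat_index:
  assumes "i < n" "k < p + 2"
  shows "design_mat p n t x $$ (i, k) = regressor t x i k"
proof -
  consider "k = 0" | "k = 1" | j where "k = Suc (Suc j)" "j < p"
    using assms(2) by (cases k rule: nat.exhaust; cases "k - 1") auto
  then show ?thesis
    using assms(1) by cases (simp_all add: design_mat_def X_in_def regressor_def mat_of_cols_index)
qed

lemma design_mat_transpose_mult_vec:
  assumes "k < p + 2" "w \<in> carrier_vec n"
  shows "((design_mat p n t x)\<^sup>T *\<^sub>v w) $ k = (\<Sum>i<n. regressor t x i k * w $ i)"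
proof -
  have "(design_mat p n t x)\<^sup>T \<in> carrier_mat (p + 2) n"
    using design_mat_carrier by simp
  from mult_mat_vec_index[OF this assms(2,1)] show ?thesis
    using assms(1) carrier_matD[OF design_mat_carrier[of p n t x]]
    by (simp add: design_mat_index)
qed

lemma design_mat_gram:
  assumes "k < p + 2" "l < p + 2"
  shows "((design_mat p n t x)\<^sup>T * design_mat p n t x) $$ (k, l) = (\<Sum>i<n. regressor t x i k * regressor t x i l)"
  using assms carrier_matD[OF design_mat_carrier[of p n t x]]
  by (simp add: scalar_prod_def design_mat_index atLeast0LessThan)

lemma true_param_carrier: "true_param p \<mu>1 \<mu>2 \<beta> \<in> carrier_vec (p + 2)"
  by (rule carrier_vecI) (simp add: true_param_def \<beta>_in_def)

lemma omitted_part_eq: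
  "X_ex p q n x *\<^sub>v \<beta>_ex p q \<beta> + Matrix.vec n e =
    Matrix.vec n (\<lambda>i. (\<Sum>j<q. \<beta> (p + j) * x i (p + j)) + e i)"
  by (rule eq_vecI) (simp_all add: X_ex_def \<beta>_ex_def scalar_prod_def atLeast0LessThan mult.commute)

text \<open>Seen from the working model, omitted covariates and noise form a single error vector;
  this is the shape that \<open>ols_remainder_bound\<close> expects.\<close>

lemma response_eq:
  "response (p + q) \<mu>1 \<mu>2 \<beta> n t x e =
    design_mat p n t x *\<^sub>v true_param p \<mu>1 \<mu>2 \<beta> +
    Matrix.vec n (\<lambda>i. (\<Sum>j<q. \<beta> (p + j) * x i (p + j)) + e i)" (is "_ = ?rhs")
proof (rule eq_vecI)
  show "dim_vec (response (p + q) \<mu>1 \<mu>2 \<beta> n t x e) = dim_vec ?rhs"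
    by (simp add: response_def)
  fix i assume "i < dim_vec ?rhs"
  then have i: "i < n" by simp
  let ?\<theta> = "true_param p \<mu>1 \<mu>2 \<beta>"
  have \<theta>: "?\<theta> $ 0 = \<mu>1" "?\<theta> $ Suc 0 = \<mu>2" "\<And>j. j < p \<Longrightarrow> ?\<theta> $ Suc (Suc j) = \<beta> j"
    by (simp_all add: true_param_def \<beta>_in_def)
  have "(design_mat p n t x *\<^sub>v ?\<theta>) $ i = (\<Sum>l<p + 2. design_mat p n t x $$ (i, l) * ?\<theta> $ l)"
    by (rule mult_mat_vec_index[OF design_mat_carrier true_param_carrier i])
  also have "\<dots> = (\<Sum>l<Suc (Suc p). regressor t x i l * ?\<theta> $ l)"
    using i by (simp add: design_mat_index)
  \<comment> \<open>Shifting the sum twice splits off the two treatment columns.\<close>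
  also have "\<dots> = \<mu>1 * t i + \<mu>2 * (1 - t i) + (\<Sum>j<p. \<beta> j * x i j)"
    unfolding sum.lessThan_Suc_shift by (simp add: \<theta> regressor_def mult.commute)
  finally have "?rhs $ i = \<mu>1 * t i + \<mu>2 * (1 - t i) + (\<Sum>j<p. \<beta> j * x i j)
      + ((\<Sum>j<q. \<beta> (p + j) * x i (p + j)) + e i)"
    using i by simp
  also have "(\<Sum>j<p + q. \<beta> j * x i j) = (\<Sum>j<p. \<beta> j * x i j) + (\<Sum>j<q. \<beta> (p + j) * x i (p + j))"
    by (induction q) (simp_all add: add.assoc)
  then have "\<mu>1 * t i + \<mu>2 * (1 - t i) + (\<Sum>j<p. \<beta> j * x i j)
      + ((\<Sum>j<q. \<beta> (p + j) * x i (p + j)) + e i) = response (p + q) \<mu>1 \<mu>2 \<beta> n t x e $ i"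
    using i by (simp add: response_def)
  finally show "response (p + q) \<mu>1 \<mu>2 \<beta> n t x e $ i = ?rhs $ i" by simp
qed

lemma regressor_treatment:
  "k < 2 \<Longrightarrow> regressor t x i k = 1/2 + (if k = 0 then 1/2 else -1/2) * (2 * t i - 1)"
  by (auto simp: regressor_def less_2_cases_iff field_simps)

section \<open>Limit of the Gram matrix and boundedness of the score\<close>

context covariate_adaptive_setting
begin

text \<open>The excluded case k = l + 2 is a covariate against itself, whose square has positive
  mean. Since \<open>l\<close> runs over all covariates, the lemma serves both the off-diagonal Gram
  entries and the omitted covariates in the score.\<close>

lemma reg_covariate_sum_bounded:
  assumes balance: "\<And>j. j < p + q \<Longrightarrow>
      bounded_in_prob M (\<lambda>n \<omega>. (\<Sum>i<n. (2 * T n i \<omega> - 1) * x n i j \<omega>) / sqrt (real n))"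
    and "k < p + 2" "l < p + q" "k \<noteq> l + 2"
  shows "bounded_in_prob M (\<lambda>n \<omega>. (\<Sum>i<n. reg n \<omega> i k * x n i l \<omega>) / sqrt (real n))"
proof (cases "k < 2")
  case True
  define s :: real where "s = (if k = 0 then 1/2 else -1/2)"
  have "(\<Sum>i<n. reg n \<omega> i k * x n i l \<omega>) / sqrt (real n) =
      1/2 * ((\<Sum>i<n. x n i l \<omega>) / sqrt (real n))
      + s * ((\<Sum>i<n. (2 * T n i \<omega> - 1) * x n i l \<omega>) / sqrt (real n))" for n \<omega>
  proof -
    have "(\<Sum>i<n. reg n \<omega> i k * x n i l \<omega>) =
        (\<Sum>i<n. 1/2 * x n i l \<omega> + s * ((2 * T n i \<omega> - 1) * x n i l \<omega>))"
      unfolding regressor_treatment[OF True] s_def[symmetric]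
      by (simp only: distrib_right mult.assoc)
    also have "\<dots> = 1/2 * (\<Sum>i<n. x n i l \<omega>) + s * (\<Sum>i<n. (2 * T n i \<omega> - 1) * x n i l \<omega>)"
      by (simp only: sum.distrib sum_distrib_left)
    finally show ?thesis by (simp only: add_divide_distrib times_divide_eq_right)
  qed
  then show ?thesis
    using assms by (simp only:) (intro bounded_in_prob_add bounded_in_prob_cmult x_sum_bounded balance)
next
  case False
  then have "reg n \<omega> i k = x n i (k - 2) \<omega>" for n \<omega> i
    by (simp add: regressor_def)
  then show ?thesis
    using x_product_sum_bounded[of "k - 2" l] assms False by simp
qed

definition gram_limit :: "nat \<Rightarrow> real" where
  "gram_limit k = (if k < 2 then 1/2 else prob_space.variance N (X (k - 2)))"

lemma gram_limit_pos: "k < p + 2 \<Longrightarrow> gram_limit k > 0"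
  using X_variance[of "k - 2"] by (auto simp: gram_limit_def)

lemma gram_tendsto:
  assumes global: "tendsto_in_prob M (\<lambda>n \<omega>. (\<Sum>i<n. 2 * T n i \<omega> - 1) / real n) 0"
    and balance: "\<And>j. j < p + q \<Longrightarrow>
      bounded_in_prob M (\<lambda>n \<omega>. (\<Sum>i<n. (2 * T n i \<omega> - 1) * x n i j \<omega>) / sqrt (real n))"
    and k: "k < p + 2" and l: "l < p + 2"
  shows "tendsto_in_prob M (\<lambda>n \<omega>. (\<Sum>i<n. reg n \<omega> i k * reg n \<omega> i l) / real n)
    (if k = l then gram_limit k else 0)"
proof -
  \<comment> \<open>Column \<open>l\<close> is a covariate here; when only \<open>k\<close> is one,
    symmetry of the product is used.\<close>
  have mixed: "tendsto_in_prob M (\<lambda>n \<omega>. (\<Sum>i<n. reg n \<omega> i k * reg n \<omega> i l) / real n) 0"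
    if "k < p + 2" "l < p + 2" "k \<noteq> l" "\<not> l < 2" for k l
  proof -
    have "reg n \<omega> i l = x n i (l - 2) \<omega>" for n \<omega> i
      using that(4) by (simp add: regressor_def)
    moreover have "bounded_in_prob M (\<lambda>n \<omega>. (\<Sum>i<n. reg n \<omega> i k * x n i (l - 2) \<omega>) / sqrt (real n))"
      by (rule reg_covariate_sum_bounded[OF balance]) (use that in auto)
    from tendsto_in_prob_0_of_bounded[OF this]
    have "tendsto_in_prob M (\<lambda>n \<omega>. (\<Sum>i<n. reg n \<omega> i k * x n i (l - 2) \<omega>) / real n) 0" by simp
    ultimately show ?thesis by simp
  qed
  show ?thesis
  proof (cases "k < 2 \<and> l < 2")
    case True
    \<comment> \<open>The constant \<open>1/4 + s * t\<close> is 1/2 for equal treatment columns and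
      0 for different ones; in the latter case s + t = 0 and the balance term disappears.\<close>
    define s t :: real where "s = (if k = 0 then 1/2 else -1/2)" and "t = (if l = 0 then 1/2 else -1/2)"
    have "tendsto_in_prob M (\<lambda>n \<omega>. (1/4 + s * t) + (s + t) / 2 * ((\<Sum>i<n. 2 * T n i \<omega> - 1) / real n))
        ((1/4 + s * t) + (s + t) / 2 * 0)"
      by (intro tendsto_in_prob_add tendsto_in_prob_cmult tendsto_in_prob_of_tendsto tendsto_const global)
    moreover have "(1/4 + s * t) + (s + t) / 2 * 0 = (if k = l then gram_limit k else 0)"
      using True by (auto simp: s_def t_def gram_limit_def less_2_cases_iff)
    ultimately have lim: "tendsto_in_prob M
        (\<lambda>n \<omega>. (1/4 + s * t) + (s + t) / 2 * ((\<Sum>i<n. 2 * T n i \<omega> - 1) / real n))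
        (if k = l then gram_limit k else 0)" by simp
    show ?thesis
    proof (rule tendsto_in_prob_cong_eventually[OF lim])
      show "(\<lambda>\<omega>. (\<Sum>i<n. reg n \<omega> i k * reg n \<omega> i l) / real n) \<in> borel_measurable (M n)" for n
        using reg_measurable k l
        by (intro borel_measurable_divide borel_measurable_sum borel_measurable_times borel_measurable_const) auto
      show "\<forall>\<^sub>F n in sequentially. \<forall>\<omega>\<in>space (M n).
          (1/4 + s * t) + (s + t) / 2 * ((\<Sum>i<n. 2 * T n i \<omega> - 1) / real n) =
          (\<Sum>i<n. reg n \<omega> i k * reg n \<omega> i l) / real n"
        using eventually_gt_at_top[of 0]
      proof (eventually_elim, intro ballI)
        fix n :: nat and \<omega> assume n: "n > 0" and \<omega>: "\<omega> \<in> space (M n)"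
        have "reg n \<omega> i k * reg n \<omega> i l = (1/4 + s * t) + (s + t) / 2 * (2 * T n i \<omega> - 1)" if "i < n" for i
        proof -
          \<comment> \<open>Because the centred assignment is a sign, the product of two treatment
            columns is affine in it, so global balance alone settles these entries.\<close>
          have "(2 * T n i \<omega> - 1) * (2 * T n i \<omega> - 1) = 1" using T_binary[OF that \<omega>] by auto
          moreover have "(1/2 + s * y) * (1/2 + t * y) = (1/4 + s * t * (y * y)) + (s + t) / 2 * y" for y
            by (simp add: field_simps)
          ultimately show ?thesis
            unfolding regressor_treatment[OF True[THEN conjunct1]]
              regressor_treatment[OF True[THEN conjunct2]] s_def[symmetric] t_def[symmetric] by simp
        qed
        then have "(\<Sum>i<n. reg n \<omega> i k * reg n \<omega> i l) =
            (\<Sum>i<n. (1/4 + s * t) + (s + t) / 2 * (2 * T n i \<omega> - 1))" by simp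
        also have "\<dots> = real n * (1/4 + s * t) + (s + t) / 2 * (\<Sum>i<n. 2 * T n i \<omega> - 1)"
          by (simp only: sum.distrib sum_distrib_left[symmetric] sum_constant card_lessThan)
             (simp add: distrib_left mult.left_commute)
        finally show "(1/4 + s * t) + (s + t) / 2 * ((\<Sum>i<n. 2 * T n i \<omega> - 1) / real n) =
            (\<Sum>i<n. reg n \<omega> i k * reg n \<omega> i l) / real n"
          using n by (simp add: add_divide_distrib)
      qed
    qed
  next
    case False
    show ?thesis
    proof (cases "k = l")
      case True
      then have "reg n \<omega> i k = x n i (k - 2) \<omega>" for n \<omega> i
        using False by (simp add: regressor_def)
      then show ?thesis
        using x_square_sum_tendsto[of "k - 2"] True False k by (simp add: gram_limit_def)
    next
      case neq: False
      show ?thesis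
      proof (cases "l < 2")
        case True
        then show ?thesis
          using mixed[OF l k] neq False by (simp add: mult.commute)
      next
        case False
        then show ?thesis using mixed[OF k l neq] neq by simp
      qed
    qed
  qed
qed

lemma score_bounded:
  assumes balance: "\<And>j. j < p + q \<Longrightarrow>
      bounded_in_prob M (\<lambda>n \<omega>. (\<Sum>i<n. (2 * T n i \<omega> - 1) * x n i j \<omega>) / sqrt (real n))"
    and k: "k < p + 2"
  shows "bounded_in_prob M (\<lambda>n \<omega>. (\<Sum>i<n. reg n \<omega> i k *
    ((\<Sum>j<q. \<beta> (p + j) * x n i (p + j) \<omega>) + \<epsilon> n i \<omega>)) / sqrt (real n))"
proof -
  have "(\<Sum>i<n. reg n \<omega> i k * ((\<Sum>j<q. \<beta> (p + j) * x n i (p + j) \<omega>) + \<epsilon> n i \<omega>)) / sqrt (real n) =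
    (\<Sum>j<q. \<beta> (p + j) * ((\<Sum>i<n. reg n \<omega> i k * x n i (p + j) \<omega>) / sqrt (real n)))
    + (\<Sum>i<n. reg n \<omega> i k * \<epsilon> n i \<omega>) / sqrt (real n)" for n \<omega>
  proof -
    have "(\<Sum>i<n. reg n \<omega> i k * ((\<Sum>j<q. \<beta> (p + j) * x n i (p + j) \<omega>) + \<epsilon> n i \<omega>)) =
      (\<Sum>i<n. \<Sum>j<q. \<beta> (p + j) * (reg n \<omega> i k * x n i (p + j) \<omega>)) + (\<Sum>i<n. reg n \<omega> i k * \<epsilon> n i \<omega>)"
      by (simp only: distrib_left sum.distrib sum_distrib_left mult.left_commute)
    also have "(\<Sum>i<n. \<Sum>j<q. \<beta> (p + j) * (reg n \<omega> i k * x n i (p + j) \<omega>)) =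
      (\<Sum>j<q. \<beta> (p + j) * (\<Sum>i<n. reg n \<omega> i k * x n i (p + j) \<omega>))"
      by (subst sum.swap) (simp only: sum_distrib_left)
    finally show ?thesis
      by (simp add: add_divide_distrib sum_divide_distrib[of _ "{..<q}"])
  qed
  \<comment> \<open>An omitted covariate never coincides with a regressor: k < p + 2 excludes k = p
    + j + 2.\<close>
  moreover have "bounded_in_prob M (\<lambda>n \<omega>. (\<Sum>i<n. reg n \<omega> i k * x n i (p + j) \<omega>) / sqrt (real n))"
    if "j < q" for j
    by (rule reg_covariate_sum_bounded[OF balance]) (use that k in auto)
  ultimately show ?thesis
    by (simp only:) (intro bounded_in_prob_add bounded_in_prob_sum bounded_in_prob_cmult
        reg_noise_sum_bounded k, simp)
qed

end

theorem theorem3p1: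
  fixes p q :: nat
    and M :: "nat \<Rightarrow> 'a measure"
    and T :: "nat \<Rightarrow> nat \<Rightarrow> 'a \<Rightarrow> real"
    and x :: "nat \<Rightarrow> nat \<Rightarrow> nat \<Rightarrow> 'a \<Rightarrow> real"
    and \<epsilon> :: "nat \<Rightarrow> nat \<Rightarrow> 'a \<Rightarrow> real"
    and N :: "'b measure"
    and X :: "nat \<Rightarrow> 'b \<Rightarrow> real"
    and L :: "'c measure"
    and \<xi> :: "nat \<Rightarrow> 'c \<Rightarrow> real"
    and \<sigma> \<mu>1 \<mu>2 :: real
    and \<beta> :: "nat \<Rightarrow> real"
    and G :: "nat \<Rightarrow> 'a \<Rightarrow> real mat"
    and Y :: "nat \<Rightarrow> 'a \<Rightarrow> real vec"
    and \<theta> :: "real vec"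
    and \<theta>_hat :: "nat \<Rightarrow> 'a \<Rightarrow> real vec"
  defines "G \<equiv> \<lambda>n \<omega>. design_mat p n (\<lambda>i. T n i \<omega>) (\<lambda>i j. x n i j \<omega>)"
    and "Y \<equiv> \<lambda>n \<omega>. response (p + q) \<mu>1 \<mu>2 \<beta> n (\<lambda>i. T n i \<omega>) (\<lambda>i j. x n i j \<omega>) (\<lambda>i. \<epsilon> n i \<omega>)"
    and "\<theta> \<equiv> true_param p \<mu>1 \<mu>2 \<beta>"
  assumes setting: "covariate_adaptive_setting p q M T x \<epsilon> N X \<sigma>"
    and A1: "tendsto_in_prob M (\<lambda>n \<omega>. (\<Sum>i<n. 2 * T n i \<omega> - 1) / real n) 0"
    and prob_L: "prob_space L"
    and \<xi>_integrable: "\<And>j. j < p + q \<Longrightarrow> integrable L (\<xi> j)"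
    and \<xi>_mean: "\<And>j. j < p + q \<Longrightarrow> prob_space.expectation L (\<xi> j) = 0"
    and A2: "tendsto_in_distr (p + q) M
               (\<lambda>n j \<omega>. (\<Sum>i<n. (2 * T n i \<omega> - 1) * x n i j \<omega>) / sqrt (real n)) L \<xi>"
    and \<theta>_hat_carrier: "\<And>n \<omega>. \<omega> \<in> space (M n) \<Longrightarrow> \<theta>_hat n \<omega> \<in> carrier_vec (p + 2)"
    and \<theta>_hat_measurable:
      "\<And>n k. k < p + 2 \<Longrightarrow> (\<lambda>\<omega>. \<theta>_hat n \<omega> $ k) \<in> borel_measurable (M n)"
    and \<theta>_hat_ols:
      "\<And>n \<omega>. \<omega> \<in> space (M n) \<Longrightarrow> is_ols_estimate (G n \<omega>) (Y n \<omega>) (\<theta>_hat n \<omega>)"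
  shows "tendsto_in_prob_vec M \<theta>_hat \<theta> \<and>
         little_o_P_1 (p + 2) M
           (\<lambda>n \<omega>. sqrt (real n) \<cdot>\<^sub>v (\<theta>_hat n \<omega> - \<theta>) -
                  (1 / sqrt (real n)) \<cdot>\<^sub>v
                    (inv_mat (limit_mat p N X) *\<^sub>v
                      ((G n \<omega>)\<^sup>T *\<^sub>v
                        (X_ex p q n (\<lambda>i j. x n i j \<omega>) *\<^sub>v \<beta>_ex p q \<beta> +
                         Matrix.vec n (\<lambda>i. \<epsilon> n i \<omega>)))))"
proof -
  interpret covariate_adaptive_setting p q M T x \<epsilon> N X \<sigma> by (rule setting)
  define d where "d = p + 2"
  define w where "w n \<omega> = Matrix.vec n (\<lambda>i. (\<Sum>j<q. \<beta> (p + j) * x n i (p + j) \<omega>) + \<epsilon> n i \<omega>)" for n \<omega>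
  define b where "b k n \<omega> = (\<Sum>i<n. reg n \<omega> i k *
      ((\<Sum>j<q. \<beta> (p + j) * x n i (p + j) \<omega>) + \<epsilon> n i \<omega>)) / sqrt (real n)" for k n \<omega>
  define D where "D n \<omega> = (\<Sum>k<d. \<Sum>l<d. \<bar>(\<Sum>i<n. reg n \<omega> i k * reg n \<omega> i l) / real n
      - (if k = l then gram_limit k else 0)\<bar>)" for n \<omega>
  \<comment> \<open>Any common upper bound of the reciprocals would serve; the sum of these positive
    terms is one.\<close>
  define C where "C = (\<Sum>k<d. 1 / gram_limit k)"
  have pos: "gram_limit k > 0" if "k < d" for k using gram_limit_pos that by (simp add: d_def)
  have C_ge: "1 / gram_limit k \<le> C" if "k < d" for k
    unfolding C_def by (rule member_le_sum) (use that pos in \<open>auto simp: less_imp_le\<close>)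
  have "C > 0" using C_ge[of 0] pos[of 0] by (auto simp: d_def intro: less_le_trans[rotated])

  have covariate_balance: "bounded_in_prob M (\<lambda>n \<omega>. (\<Sum>i<n. (2 * T n i \<omega> - 1) * x n i j \<omega>) / sqrt (real n))"
    if "j < p + q" for j
  proof (rule bounded_in_prob_of_tendsto_in_distr[OF A2 _ prob_L \<xi>_integrable[OF that] that])
    show "(\<lambda>\<omega>. (\<Sum>i<n. (2 * T n i \<omega> - 1) * x n i j \<omega>) / sqrt (real n)) \<in> borel_measurable (M n)"
      if "j < p + q" for n j
      using T_measurable x_measurable that
      by (intro borel_measurable_divide borel_measurable_sum borel_measurable_times borel_measurable_diff
          borel_measurable_const) auto
  qed
  have b_bounded: "bounded_in_prob M (b k)" if "k < d" for k
    using score_bounded[OF covariate_balance, of k] that unfolding b_def d_def by simp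
  have D_tendsto: "tendsto_in_prob M D 0"
  proof -
    have "tendsto_in_prob M (\<lambda>n \<omega>. \<bar>(\<Sum>i<n. reg n \<omega> i k * reg n \<omega> i l) / real n
      - (if k = l then gram_limit k else 0)\<bar>) 0" if "k < d" "l < d" for k l
      using tendsto_in_prob_add[OF gram_tendsto[OF A1 covariate_balance, of k l]
          tendsto_in_prob_of_tendsto[OF tendsto_const, of "- (if k = l then gram_limit k else 0)"]] that
      by (intro tendsto_in_prob_0_abs) (simp add: d_def)
    then have "tendsto_in_prob M D (\<Sum>k<d. \<Sum>l<d. 0)"
      unfolding D_def by (intro tendsto_in_prob_sum) auto
    then show ?thesis by simp
  qed
  \<comment> \<open>The \<open>k\<close>-th coordinate of the remainder. The vector expression in
    the claim is matched with it only on the space of \<open>M n\<close>, where the estimate is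
    known to have dimension \<open>d\<close>.\<close>
  define R where "R k n \<omega> = sqrt (real n) * (\<theta>_hat n \<omega> $ k - \<theta> $ k) - b k n \<omega> / gram_limit k" for k n \<omega>
  have R_measurable: "R k n \<in> borel_measurable (M n)" if "k < d" for k n
    unfolding R_def using \<theta>_hat_measurable[of k n] bounded_in_prob_measurable[OF b_bounded[OF that], of n] that
    by (intro borel_measurable_diff borel_measurable_times borel_measurable_divide borel_measurable_const)
       (auto simp: d_def)
  have G_carrier: "G n \<omega> \<in> carrier_mat n d" for n \<omega>
    unfolding G_def d_def by (rule design_mat_carrier)
  have \<theta>_carrier: "\<theta> \<in> carrier_vec d"
    unfolding \<theta>_def d_def by (rule true_param_carrier)
  have score: "((G n \<omega>)\<^sup>T *\<^sub>v w n \<omega>) $ k / sqrt (real n) = b k n \<omega>" if "k < d" for k n \<omega>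
    using that unfolding G_def b_def w_def d_def by (subst design_mat_transpose_mult_vec) auto

  \<comment> \<open>The threshold for \<open>D\<close> is the smallness condition
    \<open>C * D \<le> 1/2\<close> solved for \<open>D\<close>.\<close>
  have R_bound: "(\<Sum>k<d. \<bar>R k n \<omega>\<bar>) \<le> 2 * C\<^sup>2 * D n \<omega> * (\<Sum>k<d. \<bar>b k n \<omega>\<bar>)"
    if "n > 0" "\<omega> \<in> space (M n)" "D n \<omega> \<le> 1 / (2 * C)" for n \<omega>
    unfolding R_def
  proof (rule ols_remainder_bound[OF G_carrier \<theta>_carrier _ _ _ that(1) pos C_ge])
    show "w n \<omega> \<in> carrier_vec n" by (simp add: w_def)
    show "\<theta>_hat n \<omega> \<in> carrier_vec d" unfolding d_def by (rule \<theta>_hat_carrier[OF that(2)])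
    show "is_ols_estimate (G n \<omega>) (G n \<omega> *\<^sub>v \<theta> + w n \<omega>) (\<theta>_hat n \<omega>)"
      using \<theta>_hat_ols[OF that(2)] unfolding Y_def response_eq G_def \<theta>_def w_def .
    show "D n \<omega> = (\<Sum>k<d. \<Sum>l<d. \<bar>((G n \<omega>)\<^sup>T * G n \<omega>) $$ (k, l) / real n
        - (if k = l then gram_limit k else 0)\<bar>)"
      unfolding D_def G_def d_def by (intro sum.cong refl) (simp add: design_mat_gram)
    show "C * D n \<omega> \<le> 1/2" using that(3) \<open>C > 0\<close> by (simp add: field_simps)
    show "b k n \<omega> = ((G n \<omega>)\<^sup>T *\<^sub>v w n \<omega>) $ k / sqrt (real n)" if "k < d" for k
      by (rule score[OF that, symmetric])
  qed (use \<open>C > 0\<close> in auto)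
  have R_tendsto: "tendsto_in_prob M (R k) 0" if k: "k < d" for k
  proof (rule tendsto_in_prob_0_dominated[OF R_measurable[OF k] _ D_tendsto])
    have "tendsto_in_prob M (\<lambda>n \<omega>. 2 * C\<^sup>2 * D n \<omega>) (2 * C\<^sup>2 * 0)"
      by (rule tendsto_in_prob_cmult[OF D_tendsto])
    then have "tendsto_in_prob M (\<lambda>n \<omega>. 2 * C\<^sup>2 * D n \<omega>) 0" by simp
    \<comment> \<open>A vanishing perturbation of the Gram matrix times a score that stays bounded
      in probability.\<close>
    then show "tendsto_in_prob M (\<lambda>n \<omega>. 2 * C\<^sup>2 * D n \<omega> * (\<Sum>k<d. \<bar>b k n \<omega>\<bar>)) 0"
      by (rule tendsto_in_prob_0_mult_bounded) (intro bounded_in_prob_sum bounded_in_prob_abs b_bounded, simp)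
    show "1 / (2 * C) > 0" using \<open>C > 0\<close> by simp
    have "\<bar>R k n \<omega>\<bar> \<le> (\<Sum>k<d. \<bar>R k n \<omega>\<bar>)" for n \<omega>
      by (rule member_le_sum) (use k in auto)
    then show "\<forall>\<^sub>F n in sequentially. \<forall>\<omega>\<in>space (M n). D n \<omega> \<le> 1 / (2 * C) \<longrightarrow>
        \<bar>R k n \<omega>\<bar> \<le> 2 * C\<^sup>2 * D n \<omega> * (\<Sum>k<d. \<bar>b k n \<omega>\<bar>)"
      using R_bound by (intro eventually_mono[OF eventually_gt_at_top[of 0]]) (blast intro: order_trans)
  qed

  have "tendsto_in_prob_vec M \<theta>_hat \<theta>"
  proof (rule tendsto_in_prob_vecI[OF _ \<theta>_carrier])
    show "\<theta>_hat n \<omega> \<in> carrier_vec d" if "\<omega> \<in> space (M n)" for n \<omega>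
      unfolding d_def by (rule \<theta>_hat_carrier[OF that])
    fix k assume k: "k < d"
    \<comment> \<open>For n > 0 this is the unscaled error: the remainder tends to 0, the rescaled
      score is bounded, and both are divided by the root of n.\<close>
    have "tendsto_in_prob M (\<lambda>n \<omega>. 1 / sqrt (real n) * (R k n \<omega> + 1 / gram_limit k * b k n \<omega>)) 0"
    proof -
      have "(\<lambda>n. 1 / sqrt (real n)) \<longlonglongrightarrow> 0" by real_asymp
      note scale = tendsto_in_prob_of_tendsto[OF this]
      have "tendsto_in_prob M (\<lambda>n \<omega>. 1 / sqrt (real n) * R k n \<omega>) 0"
      proof (rule tendsto_in_prob_0_dominated[where c = 1, OF _ tendsto_in_prob_0_abs[OF R_tendsto[OF k]] D_tendsto])
        show "(\<lambda>\<omega>. 1 / sqrt (real n) * R k n \<omega>) \<in> borel_measurable (M n)" for n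
          by (intro borel_measurable_times borel_measurable_const R_measurable k)
        have "\<bar>1 / sqrt (real n) * R k n \<omega>\<bar> \<le> \<bar>R k n \<omega>\<bar>" if "n > 0" for n \<omega>
        proof -
          have "1 / sqrt (real n) \<le> 1" using that by simp
          from mult_right_mono[OF this abs_ge_zero[of "R k n \<omega>"]] show ?thesis by (simp add: abs_mult)
        qed
        then show "\<forall>\<^sub>F n in sequentially. \<forall>\<omega>\<in>space (M n). D n \<omega> \<le> 1 \<longrightarrow>
            \<bar>1 / sqrt (real n) * R k n \<omega>\<bar> \<le> \<bar>R k n \<omega>\<bar>"
          by (intro eventually_mono[OF eventually_gt_at_top[of 0]]) blast
      qed simp
      moreover have "tendsto_in_prob M (\<lambda>n \<omega>. 1 / sqrt (real n) * (1 / gram_limit k * b k n \<omega>)) 0"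
        by (intro tendsto_in_prob_0_mult_bounded[OF scale] bounded_in_prob_cmult b_bounded k)
      ultimately show ?thesis
        using tendsto_in_prob_add by (fastforce simp: distrib_left)
    qed
    then show "tendsto_in_prob M (\<lambda>n \<omega>. \<theta>_hat n \<omega> $ k - \<theta> $ k) 0"
    proof (rule tendsto_in_prob_cong_eventually)
      show "(\<lambda>\<omega>. \<theta>_hat n \<omega> $ k - \<theta> $ k) \<in> borel_measurable (M n)" for n
        using \<theta>_hat_measurable[of k n] k by (intro borel_measurable_diff borel_measurable_const) (auto simp: d_def)
      show "\<forall>\<^sub>F n in sequentially. \<forall>\<omega>\<in>space (M n).
          1 / sqrt (real n) * (R k n \<omega> + 1 / gram_limit k * b k n \<omega>) = \<theta>_hat n \<omega> $ k - \<theta> $ k"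
        by (intro eventually_mono[OF eventually_gt_at_top[of 0]]) (simp add: R_def)
    qed
  qed
  moreover have "little_o_P_1 (p + 2) M
           (\<lambda>n \<omega>. sqrt (real n) \<cdot>\<^sub>v (\<theta>_hat n \<omega> - \<theta>) -
                  (1 / sqrt (real n)) \<cdot>\<^sub>v
                    (inv_mat (limit_mat p N X) *\<^sub>v
                      ((G n \<omega>)\<^sup>T *\<^sub>v
                        (X_ex p q n (\<lambda>i j. x n i j \<omega>) *\<^sub>v \<beta>_ex p q \<beta> +
                         Matrix.vec n (\<lambda>i. \<epsilon> n i \<omega>)))))" (is "little_o_P_1 _ _ ?Z")
    unfolding little_o_P_1_def
  proof (rule tendsto_in_prob_vecI)
    let ?V = "mat_diag d (\<lambda>k. 1 / gram_limit k)"
    have "limit_mat p N X = mat_diag d gram_limit"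
      unfolding limit_mat_def gram_limit_def d_def ..
    then have inv: "inv_mat (limit_mat p N X) = ?V"
      using inv_mat_diag[of d gram_limit] pos by (simp add: less_imp_neq[THEN not_sym])
    have Z: "?Z n \<omega> = sqrt (real n) \<cdot>\<^sub>v (\<theta>_hat n \<omega> - \<theta>) -
        (1 / sqrt (real n)) \<cdot>\<^sub>v (?V *\<^sub>v ((G n \<omega>)\<^sup>T *\<^sub>v w n \<omega>))" for n \<omega>
      unfolding inv omitted_part_eq w_def ..
    have V: "?V \<in> carrier_mat d d" by simp
    have Gw: "(G n \<omega>)\<^sup>T *\<^sub>v w n \<omega> \<in> carrier_vec d" for n \<omega>
      using G_carrier[of n \<omega>] by (intro mult_mat_vec_carrier[of _ d n]) (auto simp: w_def)
    have VGw: "?V *\<^sub>v ((G n \<omega>)\<^sup>T *\<^sub>v w n \<omega>) \<in> carrier_vec d" for n \<omega>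
      by (rule mult_mat_vec_carrier[OF V Gw])
    show "?Z n \<omega> \<in> carrier_vec (p + 2)" if "\<omega> \<in> space (M n)" for n \<omega>
      unfolding Z d_def[symmetric]
      using VGw \<theta>_hat_carrier[OF that] \<theta>_carrier
      by (intro minus_carrier_vec smult_carrier_vec) (auto simp: d_def)
    show "0\<^sub>v (p + 2) \<in> carrier_vec (p + 2)" by simp
    fix k assume k: "k < p + 2"
    then have kd: "k < d" by (simp add: d_def)
    have eq: "R k n \<omega> = ?Z n \<omega> $ k - 0\<^sub>v (p + 2) $ k" if "\<omega> \<in> space (M n)" for n \<omega>
    proof -
      have "(?V *\<^sub>v ((G n \<omega>)\<^sup>T *\<^sub>v w n \<omega>)) $ k = (\<Sum>l<d. ?V $$ (k, l) * ((G n \<omega>)\<^sup>T *\<^sub>v w n \<omega>) $ l)"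
        by (rule mult_mat_vec_index[OF V Gw kd])
      also have "\<dots> = (\<Sum>l<d. if l = k then ((G n \<omega>)\<^sup>T *\<^sub>v w n \<omega>) $ k / gram_limit k else 0)"
        using kd by (intro sum.cong) (auto simp: mat_diag_def)
      also have "\<dots> = ((G n \<omega>)\<^sup>T *\<^sub>v w n \<omega>) $ k / gram_limit k" using kd by simp
      finally have Vb: "1 / sqrt (real n) * (?V *\<^sub>v ((G n \<omega>)\<^sup>T *\<^sub>v w n \<omega>)) $ k = b k n \<omega> / gram_limit k"
        unfolding score[OF kd, symmetric] by simp
      have dims: "dim_vec (\<theta>_hat n \<omega>) = d" "dim_vec \<theta> = d" "dim_vec (?V *\<^sub>v ((G n \<omega>)\<^sup>T *\<^sub>v w n \<omega>)) = d"
        using \<theta>_hat_carrier[OF that, THEN carrier_vecD] carrier_vecD[OF \<theta>_carrier] carrier_vecD[OF VGw]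
        by (simp_all add: d_def)
      have "?Z n \<omega> $ k = sqrt (real n) * (\<theta>_hat n \<omega> $ k - \<theta> $ k)
          - 1 / sqrt (real n) * (?V *\<^sub>v ((G n \<omega>)\<^sup>T *\<^sub>v w n \<omega>)) $ k"
        unfolding Z using kd dims
        by (simp only: index_minus_vec index_smult_vec)
      then show ?thesis unfolding Vb R_def using k by simp
    qed
    show "tendsto_in_prob M (\<lambda>n \<omega>. ?Z n \<omega> $ k - 0\<^sub>v (p + 2) $ k) 0"
    proof (rule tendsto_in_prob_cong_eventually[OF R_tendsto[OF kd]])
      show "(\<lambda>\<omega>. ?Z n \<omega> $ k - 0\<^sub>v (p + 2) $ k) \<in> borel_measurable (M n)" for n
        by (rule measurable_cong[OF eq, THEN iffD1], assumption) (rule R_measurable[OF kd])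
    qed (intro always_eventually allI ballI eq)
  qed
  ultimately show ?thesis by blast
qed

end
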